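(* Let $T$ be a Lie triple system and $(V,\theta)$ a representation of $T$, with $D(x_1,x_2):=\theta(x_2,x_1)-\theta(x_1,x_2)$. Let $\mathcal{L}=T\otimes T$ be the Leibniz algebra with product $(x_1,x_2)\circ(y_1,y_2)=([x_1,x_2,y_1],y_2)+(y_1,[x_1,x_2,y_2])$. Then $\mathrm{Hom}(T,V)$ equipped with the two bilinear maps determined by $$[(x_1,x_2),\phi]_L(x_3)=D(x_1,x_2)\phi(x_3)-\phi([x_1,x_2,x_3]),$$ $$[\phi,(x_1,x_2)]_R(x_3)=\phi([x_1,x_2,x_3])-D(x_1,x_2)\phi(x_3)+\theta(x_1,x_3)\phi(x_2)-\theta(x_2,x_3)\phi(x_1)$$ is a representation of the Leibniz algebra $\mathcal{L}$.
   Context: All vector spaces are over an algebraically closed field of characteristic different from 2 and 3; $(x_1,x_2)$ denotes $x_1\otimes x_2$. A Lie triple system is a vector space $T$ with a trilinear map $[\cdot,\cdot,\cdot]:T\times T\times T\to T$ such that, for all elements, $[x_1,x_1,x_2]=0$; $[x_1,x_2,x_3]+[x_2,x_3,x_1]+[x_3,x_1,x_2]=0$; and $[x_1,x_2,[y_1,y_2,y_3]]=[[x_1,x_2,y_1],y_2,y_3]+[y_1,[x_1,x_2,y_2],y_3]+[y_1,y_2,[x_1,x_2,y_3]]$. A representation $(V,\theta)$ of $T$ is a vector space $V$ with a linear map $\theta:T\otimes T\to\mathrm{End}(V)$ such that, with $D(x_1,x_2):=\theta(x_2,x_1)-\theta(x_1,x_2)$: (R1) $[D(x_1,x_2),\theta(y_1,y_2)]=\theta((x_1,x_2)\circ(y_1,y_2))$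 (commutator on the left); (R2) $\theta(x_1,[y_1,y_2,y_3])=\theta(y_2,y_3)\theta(x_1,y_1)-\theta(y_1,y_3)\theta(x_1,y_2)+D(y_1,y_2)\theta(x_1,y_3)$. A (left) Leibniz algebra is a vector space with a bilinear product satisfying $x\circ(y\circ z)=(x\circ y)\circ z+y\circ(x\circ z)$. A representation of a Leibniz algebra $\mathcal{L}$ is a vector space $M$ with bilinear maps $[\cdot,\cdot]_L:\mathcal{L}\times M\to M$ and $[\cdot,\cdot]_R:M\times\mathcal{L}\to M$ such that for all $x,y\in\mathcal{L}$, $m\in M$: (LLM) $[x\circ y,m]_L=[x,[y,m]_L]_L-[y,[x,m]_L]_L$; (MLL) $[m,x\circ y]_R=[[m,x]_R,y]_R+[x,[m,y]_R]_L$; (LML) $[x,[m,y]_R]_L=[[x,m]_L,y]_R+[m,x\circ y]_R$. *)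

theory Defs
  imports "HOL-Algebra.Algebraic_Closure"
begin

text \<open>A vector space over \<open>K\<close> is a module over \<open>K\<close>, where \<open>K\<close> is a field. The fields \<open>mult\<close>
  and \<open>one\<close> of a module record carry no meaning.\<close>

text \<open>The additive order of \<open>\<one>\<close>; \<open>group.ord\<close> is \<open>0\<close> for elements of infinite order.\<close>

definition characteristic :: "('k, 'a) ring_scheme \<Rightarrow> nat" where
  "characteristic K = group.ord (add_monoid K) \<one>\<^bsub>K\<^esub>"


section \<open>Multilinear maps and spaces of linear maps\<close>

definition linear_map ::
  "('k, 'a) ring_scheme \<Rightarrow> ('k, 'm, 'b) module_scheme \<Rightarrow> ('k, 'n, 'c) module_scheme
    \<Rightarrow> ('m \<Rightarrow> 'n) \<Rightarrow> bool" where
  "linear_map K M N f \<longleftrightarrow>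
     f \<in> carrier M \<rightarrow> carrier N \<and>
     (\<forall>x\<in>carrier M. \<forall>y\<in>carrier M. f (x \<oplus>\<^bsub>M\<^esub> y) = f x \<oplus>\<^bsub>N\<^esub> f y) \<and>
     (\<forall>a\<in>carrier K. \<forall>x\<in>carrier M. f (a \<odot>\<^bsub>M\<^esub> x) = a \<odot>\<^bsub>N\<^esub> f x)"

definition bilinear_map ::
  "('k, 'a) ring_scheme \<Rightarrow> ('k, 'm, 'b) module_scheme \<Rightarrow> ('k, 'n, 'c) module_scheme
    \<Rightarrow> ('k, 'p, 'd) module_scheme \<Rightarrow> ('m \<Rightarrow> 'n \<Rightarrow> 'p) \<Rightarrow> bool" where
  "bilinear_map K M N P f \<longleftrightarrow>
     (\<forall>x\<in>carrier M. linear_map K N P (\<lambda>y. f x y)) \<and>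
     (\<forall>y\<in>carrier N. linear_map K M P (\<lambda>x. f x y))"

definition trilinear_map ::
  "('k, 'a) ring_scheme \<Rightarrow> ('k, 'm, 'b) module_scheme \<Rightarrow> ('k, 'n, 'c) module_scheme
    \<Rightarrow> ('k, 'p, 'd) module_scheme \<Rightarrow> ('k, 'q, 'e) module_scheme
    \<Rightarrow> ('m \<Rightarrow> 'n \<Rightarrow> 'p \<Rightarrow> 'q) \<Rightarrow> bool" where
  "trilinear_map K M N P Q f \<longleftrightarrow>
     (\<forall>x\<in>carrier M. \<forall>y\<in>carrier N. linear_map K P Q (\<lambda>z. f x y z)) \<and>
     (\<forall>x\<in>carrier M. \<forall>z\<in>carrier P. linear_map K N Q (\<lambda>y. f x y z)) \<and>
     (\<forall>y\<in>carrier N. \<forall>z\<in>carrier P. linear_map K M Q (\<lambda>x. f x y z))"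

text \<open>Elements of \<open>Hom(M, N)\<close> are extensional (\<open>undefined\<close> off \<open>carrier M\<close>), so that equality
  in the carrier is equality of linear maps.\<close>

definition hom_space ::
  "('k, 'a) ring_scheme \<Rightarrow> ('k, 'm, 'b) module_scheme \<Rightarrow> ('k, 'n, 'c) module_scheme
    \<Rightarrow> ('k, 'm \<Rightarrow> 'n) module" where
  "hom_space K M N =
     \<lparr>carrier = {f \<in> extensional (carrier M). linear_map K M N f},
      monoid.mult = undefined, one = undefined,
      zero = (\<lambda>x\<in>carrier M. \<zero>\<^bsub>N\<^esub>),
      add = (\<lambda>f g. \<lambda>x\<in>carrier M. f x \<oplus>\<^bsub>N\<^esub> g x),
      smult = (\<lambda>a f. \<lambda>x\<in>carrier M. a \<odot>\<^bsub>N\<^esub> f x)\<rparr>"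

abbreviation end_space ::
  "('k, 'a) ring_scheme \<Rightarrow> ('k, 'm, 'b) module_scheme \<Rightarrow> ('k, 'm \<Rightarrow> 'm) module" where
  "end_space K V \<equiv> hom_space K V V"


section \<open>Tensor products\<close>

text \<open>\<open>M \<otimes> N\<close> is the free vector space on \<open>carrier M \<times> carrier N\<close> modulo the subspace spanned
  by the bilinearity relations.\<close>

definition free_space :: "('k, 'a) ring_scheme \<Rightarrow> 'x set \<Rightarrow> ('k, 'x \<Rightarrow> 'k) module" where
  "free_space K S =
     \<lparr>carrier = {f \<in> S \<rightarrow>\<^sub>E carrier K. finite {x \<in> S. f x \<noteq> \<zero>\<^bsub>K\<^esub>}},
      monoid.mult = undefined, one = undefined,
      zero = (\<lambda>x\<in>S. \<zero>\<^bsub>K\<^esub>),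
      add = (\<lambda>f g. \<lambda>x\<in>S. f x \<oplus>\<^bsub>K\<^esub> g x),
      smult = (\<lambda>a f. \<lambda>x\<in>S. a \<otimes>\<^bsub>K\<^esub> f x)\<rparr>"

definition free_gen :: "('k, 'a) ring_scheme \<Rightarrow> 'x set \<Rightarrow> 'x \<Rightarrow> 'x \<Rightarrow> 'k" where
  "free_gen K S x = (\<lambda>y\<in>S. if y = x then \<one>\<^bsub>K\<^esub> else \<zero>\<^bsub>K\<^esub>)"

definition submodule_span ::
  "('k, 'a) ring_scheme \<Rightarrow> ('k, 'm, 'b) module_scheme \<Rightarrow> 'm set \<Rightarrow> 'm set" where
  "submodule_span K M S = \<Inter>{H. submodule H K M \<and> S \<subseteq> H}"

definition quotient_space :: "('k, 'm, 'b) module_scheme \<Rightarrow> 'm set \<Rightarrow> ('k, 'm set) module" where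
  "quotient_space M H =
     \<lparr>carrier = a_rcosets\<^bsub>M\<^esub> H,
      monoid.mult = undefined, one = undefined,
      zero = H,
      add = set_add M,
      smult = (\<lambda>a A. \<Union>x\<in>A. H +>\<^bsub>M\<^esub> (a \<odot>\<^bsub>M\<^esub> x))\<rparr>"

definition tensor_relations ::
  "('k, 'a) ring_scheme \<Rightarrow> ('k, 'm, 'b) module_scheme \<Rightarrow> ('k, 'n, 'c) module_scheme
    \<Rightarrow> ('m \<times> 'n \<Rightarrow> 'k) set" where
  "tensor_relations K M N =
    (let F = free_space K (carrier M \<times> carrier N);
         e = (\<lambda>x y. free_gen K (carrier M \<times> carrier N) (x, y))
     in {e (x \<oplus>\<^bsub>M\<^esub> x') y \<ominus>\<^bsub>F\<^esub> (e x y \<oplus>\<^bsub>F\<^esub> e x' y) | x x' y.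
           x \<in> carrier M \<and> x' \<in> carrier M \<and> y \<in> carrier N} \<union>
        {e x (y \<oplus>\<^bsub>N\<^esub> y') \<ominus>\<^bsub>F\<^esub> (e x y \<oplus>\<^bsub>F\<^esub> e x y') | x y y'.
           x \<in> carrier M \<and> y \<in> carrier N \<and> y' \<in> carrier N} \<union>
        {e (a \<odot>\<^bsub>M\<^esub> x) y \<ominus>\<^bsub>F\<^esub> (a \<odot>\<^bsub>F\<^esub> e x y) | a x y.
           a \<in> carrier K \<and> x \<in> carrier M \<and> y \<in> carrier N} \<union>
        {e x (a \<odot>\<^bsub>N\<^esub> y) \<ominus>\<^bsub>F\<^esub> (a \<odot>\<^bsub>F\<^esub> e x y) | a x y.
           a \<in> carrier K \<and> x \<in> carrier M \<and> y \<in> carrier N})"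

definition tensor_space ::
  "('k, 'a) ring_scheme \<Rightarrow> ('k, 'm, 'b) module_scheme \<Rightarrow> ('k, 'n, 'c) module_scheme
    \<Rightarrow> ('k, ('m \<times> 'n \<Rightarrow> 'k) set) module" where
  "tensor_space K M N =
    (let F = free_space K (carrier M \<times> carrier N)
     in quotient_space F (submodule_span K F (tensor_relations K M N)))"

definition pure_tensor ::
  "('k, 'a) ring_scheme \<Rightarrow> ('k, 'm, 'b) module_scheme \<Rightarrow> ('k, 'n, 'c) module_scheme
    \<Rightarrow> 'm \<Rightarrow> 'n \<Rightarrow> ('m \<times> 'n \<Rightarrow> 'k) set" where
  "pure_tensor K M N x y =
    (let F = free_space K (carrier M \<times> carrier N)
     in submodule_span K F (tensor_relations K M N)
          +>\<^bsub>F\<^esub> free_gen K (carrier M \<times> carrier N) (x, y))"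

abbreviation tensor_square ::
  "('k, 'a) ring_scheme \<Rightarrow> ('k, 't, 'b) module_scheme \<Rightarrow> ('k, ('t \<times> 't \<Rightarrow> 'k) set) module" where
  "tensor_square K T \<equiv> tensor_space K T T"

abbreviation tens ::
  "('k, 'a) ring_scheme \<Rightarrow> ('k, 't, 'b) module_scheme \<Rightarrow> 't \<Rightarrow> 't \<Rightarrow> ('t \<times> 't \<Rightarrow> 'k) set" where
  "tens K T x y \<equiv> pure_tensor K T T x y"


section \<open>Left Leibniz algebras and their representations\<close>

locale leibniz_algebra = field K + module K L
  for K :: "('k, 'a) ring_scheme" and L :: "('k, 'l, 'b) module_scheme" +
  fixes mul :: "'l \<Rightarrow> 'l \<Rightarrow> 'l"
  assumes mul_bilinear: "bilinear_map K L L L mul"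
    and left_leibniz: "\<lbrakk>x \<in> carrier L; y \<in> carrier L; z \<in> carrier L\<rbrakk> \<Longrightarrow>
      mul x (mul y z) = mul (mul x y) z \<oplus>\<^bsub>L\<^esub> mul y (mul x z)"

locale leibniz_representation = leibniz_algebra K L mul + rep: module K M
  for K :: "('k, 'a) ring_scheme" and L :: "('k, 'l, 'b) module_scheme"
    and mul :: "'l \<Rightarrow> 'l \<Rightarrow> 'l" and M :: "('k, 'm, 'c) module_scheme" +
  fixes lact :: "'l \<Rightarrow> 'm \<Rightarrow> 'm" and ract :: "'m \<Rightarrow> 'l \<Rightarrow> 'm"
  assumes lact_bilinear: "bilinear_map K L M M lact"
    and ract_bilinear: "bilinear_map K M L M ract"
    and LLM: "\<lbrakk>x \<in> carrier L; y \<in> carrier L; m \<in> carrier M\<rbrakk> \<Longrightarrow>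
      lact (mul x y) m = lact x (lact y m) \<ominus>\<^bsub>M\<^esub> lact y (lact x m)"
    and MLL: "\<lbrakk>x \<in> carrier L; y \<in> carrier L; m \<in> carrier M\<rbrakk> \<Longrightarrow>
      ract m (mul x y) = ract (ract m x) y \<oplus>\<^bsub>M\<^esub> lact x (ract m y)"
    and LML: "\<lbrakk>x \<in> carrier L; y \<in> carrier L; m \<in> carrier M\<rbrakk> \<Longrightarrow>
      lact x (ract m y) = ract (lact x m) y \<oplus>\<^bsub>M\<^esub> ract m (mul x y)"


section \<open>Lie triple systems and their representations\<close>

locale lie_triple_system = field K + module K T
  for K :: "('k, 'a) ring_scheme" and T :: "('k, 't, 'b) module_scheme" +
  fixes br :: "'t \<Rightarrow> 't \<Rightarrow> 't \<Rightarrow> 't"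
  assumes br_trilinear: "trilinear_map K T T T T br"
    and br_alternating: "\<lbrakk>x1 \<in> carrier T; x2 \<in> carrier T\<rbrakk> \<Longrightarrow> br x1 x1 x2 = \<zero>\<^bsub>T\<^esub>"
    and br_cyclic: "\<lbrakk>x1 \<in> carrier T; x2 \<in> carrier T; x3 \<in> carrier T\<rbrakk> \<Longrightarrow>
      br x1 x2 x3 \<oplus>\<^bsub>T\<^esub> br x2 x3 x1 \<oplus>\<^bsub>T\<^esub> br x3 x1 x2 = \<zero>\<^bsub>T\<^esub>"
    and br_derivation:
      "\<lbrakk>x1 \<in> carrier T; x2 \<in> carrier T; y1 \<in> carrier T; y2 \<in> carrier T; y3 \<in> carrier T\<rbrakk> \<Longrightarrow>
       br x1 x2 (br y1 y2 y3) =
         br (br x1 x2 y1) y2 y3 \<oplus>\<^bsub>T\<^esub> br y1 (br x1 x2 y2) y3 \<oplus>\<^bsub>T\<^esub> br y1 y2 (br x1 x2 y3)"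

text \<open>The product on \<open>T \<otimes> T\<close> is prescribed on pure tensors only. The predicates for prescribed
  bilinear maps, here and for the two actions on \<open>Hom(T, V)\<close>, include extensionality, so that at
  most one function satisfies each of them.\<close>

definition is_lts_product ::
  "('k, 'a) ring_scheme \<Rightarrow> ('k, 't, 'b) module_scheme \<Rightarrow> ('t \<Rightarrow> 't \<Rightarrow> 't \<Rightarrow> 't)
    \<Rightarrow> (('t \<times> 't \<Rightarrow> 'k) set \<Rightarrow> ('t \<times> 't \<Rightarrow> 'k) set \<Rightarrow> ('t \<times> 't \<Rightarrow> 'k) set) \<Rightarrow> bool" where
  "is_lts_product K T br mul \<longleftrightarrow>
     (let L = tensor_square K T in
      mul \<in> carrier L \<rightarrow>\<^sub>E carrier L \<rightarrow>\<^sub>E carrier L \<and>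
      bilinear_map K L L L mul \<and>
      (\<forall>x1\<in>carrier T. \<forall>x2\<in>carrier T. \<forall>y1\<in>carrier T. \<forall>y2\<in>carrier T.
         mul (tens K T x1 x2) (tens K T y1 y2) =
           tens K T (br x1 x2 y1) y2 \<oplus>\<^bsub>L\<^esub> tens K T y1 (br x1 x2 y2)))"

definition lts_product ::
  "('k, 'a) ring_scheme \<Rightarrow> ('k, 't, 'b) module_scheme \<Rightarrow> ('t \<Rightarrow> 't \<Rightarrow> 't \<Rightarrow> 't)
    \<Rightarrow> ('t \<times> 't \<Rightarrow> 'k) set \<Rightarrow> ('t \<times> 't \<Rightarrow> 'k) set \<Rightarrow> ('t \<times> 't \<Rightarrow> 'k) set" where
  "lts_product K T br = (THE mul. is_lts_product K T br mul)"

definition D_op ::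
  "('k, 'a) ring_scheme \<Rightarrow> ('k, 't, 'b) module_scheme \<Rightarrow> ('k, 'v, 'c) module_scheme
    \<Rightarrow> (('t \<times> 't \<Rightarrow> 'k) set \<Rightarrow> 'v \<Rightarrow> 'v) \<Rightarrow> 't \<Rightarrow> 't \<Rightarrow> 'v \<Rightarrow> 'v" where
  "D_op K T V \<theta> x1 x2 = \<theta> (tens K T x2 x1) \<ominus>\<^bsub>end_space K V\<^esub> \<theta> (tens K T x1 x2)"

locale lts_representation = lie_triple_system K T br + rep: module K V
  for K :: "('k, 'a) ring_scheme" and T :: "('k, 't, 'b) module_scheme"
    and br :: "'t \<Rightarrow> 't \<Rightarrow> 't \<Rightarrow> 't" and V :: "('k, 'v, 'c) module_scheme" +
  fixes \<theta> :: "('t \<times> 't \<Rightarrow> 'k) set \<Rightarrow> 'v \<Rightarrow> 'v"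
  assumes theta_linear: "linear_map K (tensor_square K T) (end_space K V) \<theta>"
    and R1: "\<lbrakk>x1 \<in> carrier T; x2 \<in> carrier T; y1 \<in> carrier T; y2 \<in> carrier T\<rbrakk> \<Longrightarrow>
      compose (carrier V) (D_op K T V \<theta> x1 x2) (\<theta> (tens K T y1 y2))
        \<ominus>\<^bsub>end_space K V\<^esub> compose (carrier V) (\<theta> (tens K T y1 y2)) (D_op K T V \<theta> x1 x2)
      = \<theta> (lts_product K T br (tens K T x1 x2) (tens K T y1 y2))"
    and R2: "\<lbrakk>x1 \<in> carrier T; y1 \<in> carrier T; y2 \<in> carrier T; y3 \<in> carrier T\<rbrakk> \<Longrightarrow>
      \<theta> (tens K T x1 (br y1 y2 y3))
      = (compose (carrier V) (\<theta> (tens K T y2 y3)) (\<theta> (tens K T x1 y1))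
          \<ominus>\<^bsub>end_space K V\<^esub> compose (carrier V) (\<theta> (tens K T y1 y3)) (\<theta> (tens K T x1 y2)))
          \<oplus>\<^bsub>end_space K V\<^esub> compose (carrier V) (D_op K T V \<theta> y1 y2) (\<theta> (tens K T x1 y3))"

definition is_hom_left_action ::
  "('k, 'a) ring_scheme \<Rightarrow> ('k, 't, 'b) module_scheme \<Rightarrow> ('t \<Rightarrow> 't \<Rightarrow> 't \<Rightarrow> 't)
    \<Rightarrow> ('k, 'v, 'c) module_scheme \<Rightarrow> (('t \<times> 't \<Rightarrow> 'k) set \<Rightarrow> 'v \<Rightarrow> 'v)
    \<Rightarrow> (('t \<times> 't \<Rightarrow> 'k) set \<Rightarrow> ('t \<Rightarrow> 'v) \<Rightarrow> ('t \<Rightarrow> 'v)) \<Rightarrow> bool" where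
  "is_hom_left_action K T br V \<theta> lact \<longleftrightarrow>
     (let L = tensor_square K T; H = hom_space K T V in
      lact \<in> carrier L \<rightarrow>\<^sub>E carrier H \<rightarrow>\<^sub>E carrier H \<and>
      bilinear_map K L H H lact \<and>
      (\<forall>x1\<in>carrier T. \<forall>x2\<in>carrier T. \<forall>\<phi>\<in>carrier H. \<forall>x3\<in>carrier T.
         lact (tens K T x1 x2) \<phi> x3 =
           D_op K T V \<theta> x1 x2 (\<phi> x3) \<ominus>\<^bsub>V\<^esub> \<phi> (br x1 x2 x3)))"

definition is_hom_right_action ::
  "('k, 'a) ring_scheme \<Rightarrow> ('k, 't, 'b) module_scheme \<Rightarrow> ('t \<Rightarrow> 't \<Rightarrow> 't \<Rightarrow> 't)
    \<Rightarrow> ('k, 'v, 'c) module_scheme \<Rightarrow> (('t \<times> 't \<Rightarrow> 'k) set \<Rightarrow> 'v \<Rightarrow> 'v)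
    \<Rightarrow> (('t \<Rightarrow> 'v) \<Rightarrow> ('t \<times> 't \<Rightarrow> 'k) set \<Rightarrow> ('t \<Rightarrow> 'v)) \<Rightarrow> bool" where
  "is_hom_right_action K T br V \<theta> ract \<longleftrightarrow>
     (let L = tensor_square K T; H = hom_space K T V in
      ract \<in> carrier H \<rightarrow>\<^sub>E carrier L \<rightarrow>\<^sub>E carrier H \<and>
      bilinear_map K H L H ract \<and>
      (\<forall>x1\<in>carrier T. \<forall>x2\<in>carrier T. \<forall>\<phi>\<in>carrier H. \<forall>x3\<in>carrier T.
         ract \<phi> (tens K T x1 x2) x3 =
           \<phi> (br x1 x2 x3) \<ominus>\<^bsub>V\<^esub> D_op K T V \<theta> x1 x2 (\<phi> x3)
             \<oplus>\<^bsub>V\<^esub> \<theta> (tens K T x1 x3) (\<phi> x2) \<ominus>\<^bsub>V\<^esub> \<theta> (tens K T x2 x3) (\<phi> x1)))"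

end

theory Submission
  imports Defs
begin

text \<open>Every identity is linear in each element of \<open>T \<otimes> T\<close>, so it suffices to check it on pure tensors.
  There the product, the left action and \<open>x\<^sub>3 \<mapsto> \<theta>(x\<^sub>1, x\<^sub>3) \<phi>(x\<^sub>2) - \<theta>(x\<^sub>2, x\<^sub>3) \<phi>(x\<^sub>1)\<close> are compatible with the
  derivation action of \<open>T \<otimes> T\<close> by the derivation law and (R1), which gives the Leibniz identity,
  (LLM) and (LML). Given (LML), the identity (MLL) is equivalent to
  \<open>[[\<phi>, x]\<^sub>R + [x, \<phi>]\<^sub>L, y]\<^sub>R = 0\<close>, and this is (R2).\<close>

section \<open>Linear maps\<close>

text \<open>The obstacle is that neither the product nor the actions have a formula on all of
  \<open>T \<otimes> T\<close>: only their values on pure tensors are prescribed, and a tensor is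
  here a coset of finitely supported functions. So the universal property has to be extracted from
  that construction before these maps are known to exist. It is used in curried form: a trilinear
  map on \<open>M\<close>, \<open>N\<close>, \<open>P\<close> with values in \<open>Q\<close>
  becomes a linear map from \<open>M \<otimes> N\<close> into \<open>Hom(P, Q)\<close>, and this is
  why Hom spaces are made into modules first. One extension result then serves the product, with
  \<open>P = Q = T \<otimes> T\<close>, and both actions, with \<open>P = Q = Hom(T, V)\<close>. The
  product needs one extension more, because its right factor is prescribed only on pure tensors as
  well.\<close>

context abelian_group begin

text \<open>As rewrite rules these collect subtracted terms and carry them across the equation, so
  an identity with differences becomes an equality of two sums, which \<open>a_ac\<close>
  settles.\<close>

lemma diff_simps:
  assumes "a \<in> carrier G" "b \<in> carrier G" "c \<in> carrier G"
  shows "a \<oplus> (b \<ominus> c) = (a \<oplus> b) \<ominus> c"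
    and "(a \<ominus> b) \<oplus> c = (a \<oplus> c) \<ominus> b"
    and "(a \<ominus> b) \<ominus> c = a \<ominus> (b \<oplus> c)"
    and "a \<ominus> (b \<ominus> c) = (a \<oplus> c) \<ominus> b"
    and "a \<ominus> b = c \<longleftrightarrow> a = c \<oplus> b"
    and "a = c \<ominus> b \<longleftrightarrow> a \<oplus> b = c"
  using assms add.inv_solve_right[of c a b] add.inv_solve_right'[of c a b]
    add.inv_solve_right[of a c b] add.inv_solve_right'[of a c b]
  by (auto simp: minus_eq minus_add a_ac)

end

lemma (in abelian_group) diff_add_diff:
  "\<lbrakk>a \<in> carrier G; b \<in> carrier G; c \<in> carrier G; d \<in> carrier G\<rbrakk>
    \<Longrightarrow> (a \<ominus> b) \<oplus> (c \<ominus> d) = (a \<oplus> c) \<ominus> (b \<oplus> d)"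
  by (simp add: minus_eq minus_add a_ac)

lemma (in module) smult_diff:
  "\<lbrakk>a \<in> carrier R; x \<in> carrier M; y \<in> carrier M\<rbrakk> \<Longrightarrow> a \<odot>\<^bsub>M\<^esub> (x \<ominus>\<^bsub>M\<^esub> y) = a \<odot>\<^bsub>M\<^esub> x \<ominus>\<^bsub>M\<^esub> a \<odot>\<^bsub>M\<^esub> y"
  by (simp add: M.minus_eq smult_r_distr smult_r_minus)

lemma linear_mapD:
  assumes "linear_map K M N f"
  shows "x \<in> carrier M \<Longrightarrow> f x \<in> carrier N"
    and "\<lbrakk>x \<in> carrier M; y \<in> carrier M\<rbrakk> \<Longrightarrow> f (x \<oplus>\<^bsub>M\<^esub> y) = f x \<oplus>\<^bsub>N\<^esub> f y"
    and "\<lbrakk>a \<in> carrier K; x \<in> carrier M\<rbrakk> \<Longrightarrow> f (a \<odot>\<^bsub>M\<^esub> x) = a \<odot>\<^bsub>N\<^esub> f x"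
  using assms by (auto simp: linear_map_def)

lemma linear_map_zero_minus:
  assumes "module K M" "module K N" and f: "linear_map K M N f"
  shows "f \<zero>\<^bsub>M\<^esub> = \<zero>\<^bsub>N\<^esub>"
    and "\<lbrakk>x \<in> carrier M; y \<in> carrier M\<rbrakk> \<Longrightarrow> f (x \<ominus>\<^bsub>M\<^esub> y) = f x \<ominus>\<^bsub>N\<^esub> f y"
proof -
  interpret M: module K M by fact
  interpret N: module K N by fact
  interpret abelian_group_hom M N f
    by (rule abelian_group_homI)
      (auto intro!: homI M.abelian_group_axioms N.abelian_group_axioms
        group_hom.intro group_hom_axioms.intro M.a_group N.a_group
        simp: linear_mapD[OF f])
  show "f \<zero>\<^bsub>M\<^esub> = \<zero>\<^bsub>N\<^esub>" by simp
  show "f (x \<ominus>\<^bsub>M\<^esub> y) = f x \<ominus>\<^bsub>N\<^esub> f y" if "x \<in> carrier M" "y \<in> carrier M"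
    using that by (simp add: M.minus_eq N.minus_eq)
qed

section \<open>Hom spaces as modules\<close>

lemma hom_spaceD:
  assumes "f \<in> carrier (hom_space K M N)"
  shows "linear_map K M N f" and "x \<in> carrier M \<Longrightarrow> f x \<in> carrier N"
  using assms by (auto simp: hom_space_def linear_map_def)

lemma hom_space_ext:
  assumes "f \<in> carrier (hom_space K M N)" "g \<in> carrier (hom_space K M N)"
    and "\<And>x. x \<in> carrier M \<Longrightarrow> f x = g x"
  shows "f = g"
  using assms by (auto simp: hom_space_def intro: extensionalityI)

lemma hom_space_restrict:
  assumes "module K M" and "linear_map K M N f"
  shows "(\<lambda>x\<in>carrier M. f x) \<in> carrier (hom_space K M N)"
proof -
  interpret M: module K M by fact
  show ?thesis
    using assms(2) by (auto simp: hom_space_def linear_map_def)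
qed

lemma hom_space_apply:
  assumes "x \<in> carrier M"
  shows "\<zero>\<^bsub>hom_space K M N\<^esub> x = \<zero>\<^bsub>N\<^esub>"
    and "(f \<oplus>\<^bsub>hom_space K M N\<^esub> g) x = f x \<oplus>\<^bsub>N\<^esub> g x"
    and "(a \<odot>\<^bsub>hom_space K M N\<^esub> f) x = a \<odot>\<^bsub>N\<^esub> f x"
  using assms by (simp_all add: hom_space_def)

lemma linear_map_combinations:
  assumes "module K M" "module K N"
  shows "linear_map K M N (\<lambda>x. \<zero>\<^bsub>N\<^esub>)"
    and "\<lbrakk>linear_map K M N f; linear_map K M N g\<rbrakk> \<Longrightarrow> linear_map K M N (\<lambda>x. f x \<oplus>\<^bsub>N\<^esub> g x)"
    and "\<lbrakk>linear_map K M N f; linear_map K M N g\<rbrakk> \<Longrightarrow> linear_map K M N (\<lambda>x. f x \<ominus>\<^bsub>N\<^esub> g x)"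
    and "\<lbrakk>a \<in> carrier K; linear_map K M N f\<rbrakk> \<Longrightarrow> linear_map K M N (\<lambda>x. a \<odot>\<^bsub>N\<^esub> f x)"
proof -
  interpret M: module K M by fact
  interpret N: module K N by fact
  show "linear_map K M N (\<lambda>x. \<zero>\<^bsub>N\<^esub>)"
    by (auto simp: linear_map_def)
  show "linear_map K M N (\<lambda>x. f x \<oplus>\<^bsub>N\<^esub> g x)"
    if fg: "linear_map K M N f" "linear_map K M N g"
    using fg[THEN linear_mapD(1)] fg[THEN linear_mapD(2)] fg[THEN linear_mapD(3)]
    by (auto simp: linear_map_def N.smult_r_distr N.a_ac)
  show "linear_map K M N (\<lambda>x. f x \<ominus>\<^bsub>N\<^esub> g x)"
    if fg: "linear_map K M N f" "linear_map K M N g"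
    using fg[THEN linear_mapD(1)] fg[THEN linear_mapD(2)] fg[THEN linear_mapD(3)]
    by (auto simp: linear_map_def N.smult_r_distr N.smult_r_minus N.minus_eq N.minus_add N.a_ac)
  show "linear_map K M N (\<lambda>x. a \<odot>\<^bsub>N\<^esub> f x)"
    if a: "a \<in> carrier K" and f: "linear_map K M N f"
    using a linear_mapD[OF f]
    by (auto simp: linear_map_def N.smult_r_distr N.smult_assoc1[symmetric] M.R.m_comm)
qed

lemma linear_map_comp:
  assumes "linear_map K M N f" "linear_map K N P g"
  shows "linear_map K M P (\<lambda>x. g (f x))"
  using assms by (auto simp: linear_map_def Pi_iff)

lemma hom_space_module:
  assumes M: "module K M" and N: "module K N"
  shows "module K (hom_space K M N)"
proof -
  interpret M: module K M by fact
  interpret N: module K N by fact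
  let ?H = "hom_space K M N"
  note combs = linear_map_combinations[OF M N] and D = hom_spaceD(1)
  have carr: "\<zero>\<^bsub>?H\<^esub> \<in> carrier ?H"
    "\<And>f g. \<lbrakk>f \<in> carrier ?H; g \<in> carrier ?H\<rbrakk> \<Longrightarrow> f \<oplus>\<^bsub>?H\<^esub> g \<in> carrier ?H"
    "\<And>a f. \<lbrakk>a \<in> carrier K; f \<in> carrier ?H\<rbrakk> \<Longrightarrow> a \<odot>\<^bsub>?H\<^esub> f \<in> carrier ?H"
    using hom_space_restrict[OF M combs(1)] hom_space_restrict[OF M combs(2)[OF D D]]
      hom_space_restrict[OF M combs(4)[OF _ D]]
    by (auto simp: hom_space_def)
  show ?thesis
  proof (rule moduleI)
    show "abelian_group ?H"
    proof (rule abelian_groupI)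
      fix f assume f: "f \<in> carrier ?H"
      \<comment> \<open>The inverse is written as zero minus \<open>f x\<close>, so that its
        linearity is an instance of \<open>combs\<close>.\<close>
      have "(\<lambda>x\<in>carrier M. \<zero>\<^bsub>N\<^esub> \<ominus>\<^bsub>N\<^esub> f x) \<in> carrier ?H"
        by (intro hom_space_restrict M combs D f)
      moreover have "(\<lambda>x\<in>carrier M. \<zero>\<^bsub>N\<^esub> \<ominus>\<^bsub>N\<^esub> f x) \<oplus>\<^bsub>?H\<^esub> f = \<zero>\<^bsub>?H\<^esub>"
        using hom_spaceD(2)[OF f]
        by (intro hom_space_ext[of _ K M N] carr calculation f) (simp_all add: hom_space_apply N.minus_eq N.l_neg)
      ultimately show "\<exists>g\<in>carrier ?H. g \<oplus>\<^bsub>?H\<^esub> f = \<zero>\<^bsub>?H\<^esub>" by blast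
    qed (auto intro!: hom_space_ext[of _ K M N] carr simp: hom_space_apply N.a_ac hom_spaceD(2))
  qed (auto intro!: hom_space_ext[of _ K M N] carr
      simp: hom_space_apply N.smult_l_distr N.smult_r_distr N.smult_assoc1 hom_spaceD(2) M.is_cring)
qed

lemma hom_space_eval:
  assumes "x \<in> carrier M"
  shows "linear_map K (hom_space K M N) N (\<lambda>f. f x)"
  using assms by (auto simp: linear_map_def hom_space_apply hom_spaceD(2))

text \<open>Subtraction in \<open>hom_space\<close> goes through the group inverse, which has no
  pointwise definition; it is pointwise because evaluation at \<open>x\<close> is a linear
  map.\<close>

lemma hom_space_minus_apply:
  assumes "module K M" "module K N" "x \<in> carrier M"
    and "f \<in> carrier (hom_space K M N)" "g \<in> carrier (hom_space K M N)"
  shows "(f \<ominus>\<^bsub>hom_space K M N\<^esub> g) x = f x \<ominus>\<^bsub>N\<^esub> g x"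
  using linear_map_zero_minus(2)[OF hom_space_module[OF assms(1,2)] assms(2) hom_space_eval[OF assms(3)]] assms(4,5) .

section \<open>Free modules and quotient modules\<close>

lemma free_spaceD:
  assumes "f \<in> carrier (free_space K S)"
  shows "x \<in> S \<Longrightarrow> f x \<in> carrier K" and "finite {x \<in> S. f x \<noteq> \<zero>\<^bsub>K\<^esub>}"
  using assms by (auto simp: free_space_def)

lemma free_space_ext:
  assumes "f \<in> carrier (free_space K S)" "g \<in> carrier (free_space K S)"
    and "\<And>x. x \<in> S \<Longrightarrow> f x = g x"
  shows "f = g"
  using assms by (auto simp: free_space_def PiE_iff intro: extensionalityI)

lemma free_space_apply:
  assumes "x \<in> S"
  shows "\<zero>\<^bsub>free_space K S\<^esub> x = \<zero>\<^bsub>K\<^esub>"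
    and "(f \<oplus>\<^bsub>free_space K S\<^esub> g) x = f x \<oplus>\<^bsub>K\<^esub> g x"
    and "(a \<odot>\<^bsub>free_space K S\<^esub> f) x = a \<otimes>\<^bsub>K\<^esub> f x"
  using assms by (simp_all add: free_space_def)

lemma free_space_module:
  assumes "cring K"
  shows "module K (free_space K S)"
proof -
  interpret cring K by fact
  let ?F = "free_space K S"
  \<comment> \<open>The support of \<open>h\<close> lies in the union of two finite supports. Sums
    use it with two functions, multiples and negatives with the same function twice.\<close>
  have carrI: "(\<lambda>x\<in>S. h x) \<in> carrier ?F"
    if "f \<in> carrier ?F" "g \<in> carrier ?F" "\<And>x. x \<in> S \<Longrightarrow> h x \<in> carrier K"
      "\<And>x. \<lbrakk>x \<in> S; f x = \<zero>\<^bsub>K\<^esub>; g x = \<zero>\<^bsub>K\<^esub>\<rbrakk> \<Longrightarrow> h x = \<zero>\<^bsub>K\<^esub>" for f g h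
  proof -
    have "finite {x \<in> S. (\<lambda>x\<in>S. h x) x \<noteq> \<zero>\<^bsub>K\<^esub>}"
      by (rule finite_subset[OF _ finite_UnI[OF free_spaceD(2)[OF that(1)] free_spaceD(2)[OF that(2)]]])
        (use that(4) in auto)
    with that(3) show ?thesis by (simp add: free_space_def)
  qed
  have zero: "\<zero>\<^bsub>?F\<^esub> \<in> carrier ?F"
    by (simp add: free_space_def cong: conj_cong)
  have add: "f \<oplus>\<^bsub>?F\<^esub> g \<in> carrier ?F" if "f \<in> carrier ?F" "g \<in> carrier ?F" for f g
    using carrI[OF that, of "\<lambda>x. f x \<oplus>\<^bsub>K\<^esub> g x"] that[THEN free_spaceD(1)]
    by (simp add: free_space_def)
  have smult: "a \<odot>\<^bsub>?F\<^esub> f \<in> carrier ?F" if "a \<in> carrier K" "f \<in> carrier ?F" for a f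
    using carrI[OF that(2,2), of "\<lambda>x. a \<otimes>\<^bsub>K\<^esub> f x"] that free_spaceD(1)[OF that(2)]
    by (simp add: free_space_def)
  note ext = free_space_ext[of _ K S] and simps = free_space_apply free_spaceD(1)
  show ?thesis
  proof (rule moduleI)
    show "abelian_group ?F"
    proof (rule abelian_groupI)
      fix f assume f: "f \<in> carrier ?F"
      let ?g = "\<lambda>x\<in>S. \<ominus>\<^bsub>K\<^esub> f x"
      have g: "?g \<in> carrier ?F"
        by (rule carrI[OF f f]) (simp_all add: free_spaceD(1)[OF f])
      moreover have "?g \<oplus>\<^bsub>?F\<^esub> f = \<zero>\<^bsub>?F\<^esub>"
        by (intro ext add g f zero) (simp_all add: simps l_neg f free_spaceD(1)[OF f])
      ultimately show "\<exists>g\<in>carrier ?F. g \<oplus>\<^bsub>?F\<^esub> f = \<zero>\<^bsub>?F\<^esub>" by blast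
    qed (auto intro!: ext add zero simp: simps a_ac)
  qed (auto intro!: ext add smult simp: simps l_distr r_distr m_assoc is_cring)
qed

lemma free_gen_closed:
  assumes "cring K" "x \<in> S"
  shows "free_gen K S x \<in> carrier (free_space K S)"
proof -
  interpret cring K by fact
  have "finite {y \<in> S. (if y = x then \<one>\<^bsub>K\<^esub> else \<zero>\<^bsub>K\<^esub>) \<noteq> \<zero>\<^bsub>K\<^esub>}"
    by (rule finite_subset[of _ "{x}"]) auto
  then show ?thesis
    by (auto simp: free_space_def free_gen_def PiE_iff cong: conj_cong)
qed

text \<open>Induction on the finite support: every element is a combination of generators, and
  splitting off one generator at a time avoids writing that combination as a sum.\<close>

lemma free_space_induct [consumes 2, case_names zero gen add smult]:
  fixes K (structure)
  assumes K: "cring K" and f: "f \<in> carrier (free_space K S)"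
    and P_zero: "P \<zero>\<^bsub>free_space K S\<^esub>"
    and P_gen: "\<And>x. x \<in> S \<Longrightarrow> P (free_gen K S x)"
    and P_add: "\<And>f g. \<lbrakk>f \<in> carrier (free_space K S); g \<in> carrier (free_space K S); P f; P g\<rbrakk>
      \<Longrightarrow> P (f \<oplus>\<^bsub>free_space K S\<^esub> g)"
    and P_smult: "\<And>a f. \<lbrakk>a \<in> carrier K; f \<in> carrier (free_space K S); P f\<rbrakk>
      \<Longrightarrow> P (a \<odot>\<^bsub>free_space K S\<^esub> f)"
  shows "P f"
proof -
  interpret cring K by fact
  let ?F = "free_space K S"
  interpret F: module K ?F by (rule free_space_module[OF K])
  have "P f" if "finite A" "f \<in> carrier ?F" "{x \<in> S. f x \<noteq> \<zero>} = A" for A f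
    using that
  proof (induction arbitrary: f)
    case empty
    then have "f = \<zero>\<^bsub>?F\<^esub>"
      by (auto simp: free_space_def PiE_iff intro!: extensionalityI[of _ S])
    with P_zero show ?case by simp
  next
    case (insert x A)
    then have x: "x \<in> S" and fx: "f x \<in> carrier K"
      by (auto simp: free_space_def PiE_iff)
    \<comment> \<open>Erasing the value at \<open>x\<close> removes exactly \<open>x\<close> from
      the support; the erased part is \<open>f x\<close> times the generator at
      \<open>x\<close>.\<close>
    define g where "g = f(x := \<zero>)"
    have supp: "{y \<in> S. g y \<noteq> \<zero>} = A"
      using insert.prems insert.hyps by (auto simp: g_def)
    have g: "g \<in> carrier ?F"
      using insert.prems supp insert.hyps(1) x
      by (auto simp: free_space_def PiE_iff g_def extensional_def)
    have "f = g \<oplus>\<^bsub>?F\<^esub> f x \<odot>\<^bsub>?F\<^esub> free_gen K S x"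
      using insert.prems(1) x
      by (auto simp: free_space_def free_gen_def PiE_iff g_def intro!: extensionalityI[of _ S])
    moreover have "P (g \<oplus>\<^bsub>?F\<^esub> f x \<odot>\<^bsub>?F\<^esub> free_gen K S x)"
      by (intro P_add P_smult P_gen g F.smult_closed free_gen_closed K x fx insert.IH[OF g supp])
    ultimately show ?case by simp
  qed
  then show ?thesis using f by (auto simp: free_space_def)
qed

lemma free_space_lift:
  assumes N: "module K N" and g: "g \<in> S \<rightarrow> carrier N"
  shows "\<exists>h. linear_map K (free_space K S) N h \<and> (\<forall>x\<in>S. h (free_gen K S x) = g x)"
proof -
  interpret N: module K N by fact
  let ?F = "free_space K S"
  define h where "h f = (\<Oplus>\<^bsub>N\<^esub>x\<in>{x \<in> S. f x \<noteq> \<zero>\<^bsub>K\<^esub>}. f x \<odot>\<^bsub>N\<^esub> g x)" for f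
  have gS: "g x \<in> carrier N" if "x \<in> S" for x
    using that g by auto
  have closed: "f x \<odot>\<^bsub>N\<^esub> g x \<in> carrier N" if "f \<in> carrier ?F" "x \<in> S" for f x
    using that g by (auto simp: free_space_def)
  \<comment> \<open>The supports of \<open>f\<close>, \<open>f'\<close> and their sum differ, so
    additivity cannot be read off the definition of \<open>h\<close>. Summing over any finite
    superset of the support gives the same value, and a common superset can then be chosen.\<close>
  have h: "h f = (\<Oplus>\<^bsub>N\<^esub>x\<in>A. f x \<odot>\<^bsub>N\<^esub> g x)"
    if "f \<in> carrier ?F" "finite A" "A \<subseteq> S" "\<And>x. \<lbrakk>x \<in> S; f x \<noteq> \<zero>\<^bsub>K\<^esub>\<rbrakk> \<Longrightarrow> x \<in> A" for f A
    unfolding h_def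
    by (rule N.add.finprod_mono_neutral_cong_left) (use that closed g in \<open>auto intro!: N.smult_l_null\<close>)
  have fin: "finite {x \<in> S. f x \<noteq> \<zero>\<^bsub>K\<^esub>}" if "f \<in> carrier ?F" for f
    using that by (simp add: free_space_def)
  interpret F: module K ?F by (rule free_space_module) (rule N.R.is_cring)
  have "linear_map K ?F N h"
    unfolding linear_map_def
  proof (intro conjI ballI)
    show "h \<in> carrier ?F \<rightarrow> carrier N"
      by (auto simp: h_def intro!: N.finsum_closed closed)
  next
    fix f f' assume f: "f \<in> carrier ?F" "f' \<in> carrier ?F"
    let ?A = "{x \<in> S. f x \<noteq> \<zero>\<^bsub>K\<^esub>} \<union> {x \<in> S. f' x \<noteq> \<zero>\<^bsub>K\<^esub>}"
    have A: "finite ?A" "?A \<subseteq> S" using f fin by auto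
    have "h (f \<oplus>\<^bsub>?F\<^esub> f') = (\<Oplus>\<^bsub>N\<^esub>x\<in>?A. (f \<oplus>\<^bsub>?F\<^esub> f') x \<odot>\<^bsub>N\<^esub> g x)"
      by (rule h) (use f A in \<open>auto simp: free_space_apply\<close>)
    also have "\<dots> = (\<Oplus>\<^bsub>N\<^esub>x\<in>?A. f x \<odot>\<^bsub>N\<^esub> g x \<oplus>\<^bsub>N\<^esub> f' x \<odot>\<^bsub>N\<^esub> g x)"
      by (rule N.finsum_cong') (use f closed gS in \<open>auto simp: free_space_apply free_spaceD(1) N.smult_l_distr\<close>)
    also have "\<dots> = h f \<oplus>\<^bsub>N\<^esub> h f'"
      using f A closed by (subst N.finsum_addf) (auto simp: h[of _ ?A])
    finally show "h (f \<oplus>\<^bsub>?F\<^esub> f') = h f \<oplus>\<^bsub>N\<^esub> h f'" .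
  next
    fix a f assume a: "a \<in> carrier K" and f: "f \<in> carrier ?F"
    let ?A = "{x \<in> S. f x \<noteq> \<zero>\<^bsub>K\<^esub>}"
    have "h (a \<odot>\<^bsub>?F\<^esub> f) = (\<Oplus>\<^bsub>N\<^esub>x\<in>?A. (a \<odot>\<^bsub>?F\<^esub> f) x \<odot>\<^bsub>N\<^esub> g x)"
      by (rule h) (use f a fin in \<open>auto simp: free_space_apply\<close>)
    also have "\<dots> = (\<Oplus>\<^bsub>N\<^esub>x\<in>?A. a \<odot>\<^bsub>N\<^esub> (f x \<odot>\<^bsub>N\<^esub> g x))"
      by (rule N.finsum_cong') (use f a closed gS in \<open>auto simp: free_space_apply free_spaceD(1) N.smult_assoc1\<close>)
    also have "\<dots> = a \<odot>\<^bsub>N\<^esub> h f"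
      unfolding h_def using f a fin closed by (subst N.finsum_smult_ldistr) auto
    finally show "h (a \<odot>\<^bsub>?F\<^esub> f) = a \<odot>\<^bsub>N\<^esub> h f" .
  qed
  moreover have "h (free_gen K S x) = g x" if x: "x \<in> S" for x
  proof -
    have "h (free_gen K S x) = (\<Oplus>\<^bsub>N\<^esub>y\<in>{x}. free_gen K S x y \<odot>\<^bsub>N\<^esub> g y)"
      by (rule h) (use x free_gen_closed[OF N.R.is_cring x] in \<open>auto simp: free_gen_def split: if_splits\<close>)
    then show ?thesis using x g by (auto simp: free_gen_def Pi_iff)
  qed
  ultimately show ?thesis by blast
qed

section \<open>Spans and quotients\<close>

lemma submodule_span_properties:
  assumes "module K M" and "S \<subseteq> carrier M"
  shows "submodule (submodule_span K M S) K M" and "S \<subseteq> submodule_span K M S"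
    and "\<lbrakk>submodule H K M; S \<subseteq> H\<rbrakk> \<Longrightarrow> submodule_span K M S \<subseteq> H"
proof -
  interpret module K M by fact
  show "submodule (submodule_span K M S) K M"
  proof (rule submoduleI)
    show "submodule_span K M S \<subseteq> carrier M"
      using carrier_is_submodule assms(2) by (auto simp: submodule_span_def)
    show "\<zero>\<^bsub>M\<^esub> \<in> submodule_span K M S"
      using subgroup.one_closed[OF submodule.axioms(1)]
      by (fastforce simp: submodule_span_def)
  qed (auto simp: submodule_span_def intro: submoduleE(3-5))
qed (auto simp: submodule_span_def)

context
  fixes K :: "('k, 'a) ring_scheme" and M :: "('k, 'm, 'b) module_scheme" and H
  assumes M: "module K M" and H: "submodule H K M"
begin

interpretation M: module K M by (rule M)

interpretation H: abelian_subgroup H M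
  by (rule abelian_subgroupI3)
    (auto simp: additive_subgroup_def submodule.axioms(1)[OF H] M.abelian_group_axioms)

lemma quotient_space_carrier:
  "carrier (quotient_space M H) = (\<lambda>x. H +>\<^bsub>M\<^esub> x) ` carrier M"
  by (auto simp: quotient_space_def A_RCOSETS_def RCOSETS_def a_r_coset_def)

lemma quotient_space_coset_eq:
  assumes "x \<in> carrier M" "y \<in> carrier M"
  shows "H +>\<^bsub>M\<^esub> x = H +>\<^bsub>M\<^esub> y \<longleftrightarrow> x \<ominus>\<^bsub>M\<^esub> y \<in> H"
  using assms H.a_rcos_module[OF assms(2,1)] H.a_repr_independence'[OF _ assms(2)]
    H.a_rcos_self[OF assms(1)] by (auto simp: M.minus_eq)

text \<open>Zero is given a representative, so that the module axioms reduce to arithmetic of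
  representatives. Later calls delete \<open>a_coset_add_zero\<close>, which would rewrite the coset
  back to \<open>H\<close>.\<close>

lemma quotient_space_zero: "\<zero>\<^bsub>quotient_space M H\<^esub> = H +>\<^bsub>M\<^esub> \<zero>\<^bsub>M\<^esub>"
  using H.a_subset by (simp add: quotient_space_def)

lemma quotient_space_add:
  assumes "x \<in> carrier M" "y \<in> carrier M"
  shows "(H +>\<^bsub>M\<^esub> x) \<oplus>\<^bsub>quotient_space M H\<^esub> (H +>\<^bsub>M\<^esub> y) = H +>\<^bsub>M\<^esub> (x \<oplus>\<^bsub>M\<^esub> y)"
  using assms by (simp add: quotient_space_def H.a_rcos_sum)

text \<open>The scalar multiple is defined as a union over all representatives; since
  \<open>H\<close> is stable under scalars, all cosets in that union coincide.\<close>

lemma quotient_space_smult: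
  assumes "a \<in> carrier K" "x \<in> carrier M"
  shows "a \<odot>\<^bsub>quotient_space M H\<^esub> (H +>\<^bsub>M\<^esub> x) = H +>\<^bsub>M\<^esub> (a \<odot>\<^bsub>M\<^esub> x)"
proof -
  have "H +>\<^bsub>M\<^esub> (a \<odot>\<^bsub>M\<^esub> z) = H +>\<^bsub>M\<^esub> (a \<odot>\<^bsub>M\<^esub> x)" if "z \<in> H +>\<^bsub>M\<^esub> x" for z
  proof -
    have z: "z \<in> carrier M" using that assms(2) H.a_elemrcos_carrier by blast
    have "z \<ominus>\<^bsub>M\<^esub> x \<in> H"
      using that quotient_space_coset_eq[OF z assms(2)] H.a_repr_independence'[OF that assms(2)]
      by simp
    then have "a \<odot>\<^bsub>M\<^esub> (z \<ominus>\<^bsub>M\<^esub> x) \<in> H" by (rule M.submoduleE(4)[OF H assms(1)])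
    then show ?thesis
      using assms z by (simp add: quotient_space_coset_eq M.minus_eq M.smult_r_distr M.smult_r_minus)
  qed
  then have "(\<Union>z\<in>H +>\<^bsub>M\<^esub> x. H +>\<^bsub>M\<^esub> (a \<odot>\<^bsub>M\<^esub> z)) = (\<Union>z\<in>H +>\<^bsub>M\<^esub> x. H +>\<^bsub>M\<^esub> (a \<odot>\<^bsub>M\<^esub> x))"
    by (rule SUP_cong[OF refl])
  then show ?thesis
    using H.a_rcos_self[OF assms(2)] by (simp add: quotient_space_def) blast
qed

lemmas quotient_space_simps =
  quotient_space_carrier quotient_space_zero quotient_space_add quotient_space_smult

lemma quotient_space_module: "module K (quotient_space M H)"
proof (rule moduleI)
  show "abelian_group (quotient_space M H)"
  proof (rule abelian_groupI)
    fix A assume "A \<in> carrier (quotient_space M H)"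
    then obtain x where "x \<in> carrier M" "A = H +>\<^bsub>M\<^esub> x"
      by (auto simp: quotient_space_carrier)
    then show "\<exists>B\<in>carrier (quotient_space M H). B \<oplus>\<^bsub>quotient_space M H\<^esub> A = \<zero>\<^bsub>quotient_space M H\<^esub>"
      by (intro bexI[of _ "H +>\<^bsub>M\<^esub> (\<ominus>\<^bsub>M\<^esub> x)"]) (auto simp: quotient_space_simps M.l_neg simp del: M.a_coset_add_zero)
  qed (auto simp: quotient_space_simps M.a_ac simp del: M.a_coset_add_zero)
qed (auto simp: quotient_space_simps M.smult_l_distr M.smult_r_distr M.smult_assoc1 M.R.is_cring)

lemma quotient_space_lift:
  assumes N: "module K N" and g: "linear_map K M N g" and "\<And>x. x \<in> H \<Longrightarrow> g x = \<zero>\<^bsub>N\<^esub>"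
  shows "\<exists>h. linear_map K (quotient_space M H) N h \<and> (\<forall>x\<in>carrier M. h (H +>\<^bsub>M\<^esub> x) = g x)"
proof -
  interpret N: module K N by (rule N)
  have g_eq: "g x = g y" if "x \<in> carrier M" "y \<in> carrier M" "H +>\<^bsub>M\<^esub> x = H +>\<^bsub>M\<^esub> y" for x y
  proof -
    have "g (x \<ominus>\<^bsub>M\<^esub> y) = \<zero>\<^bsub>N\<^esub>"
      using that quotient_space_coset_eq assms(3) by simp
    then show ?thesis
      using that linear_mapD(1)[OF g] by (simp add: linear_map_zero_minus(2)[OF M N g] N.diff_simps)
  qed
  \<comment> \<open>The choice of representative is harmless by \<open>g_eq\<close>: representatives
    of one coset differ by an element of \<open>H\<close>, where \<open>g\<close> vanishes.\<close>
  define h where "h A = g (SOME x. x \<in> carrier M \<and> A = H +>\<^bsub>M\<^esub> x)" for A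
  have h: "h (H +>\<^bsub>M\<^esub> x) = g x" if "x \<in> carrier M" for x
    unfolding h_def
    by (rule someI2[of _ x], use that in blast) (elim conjE, rule g_eq, use that in simp_all)
  then have "linear_map K (quotient_space M H) N h"
    using linear_mapD[OF g] by (auto simp: linear_map_def quotient_space_simps)
  with h show ?thesis by blast
qed

end

section \<open>Tensor products\<close>

lemma bilinear_mapI:
  assumes "\<And>x y. \<lbrakk>x \<in> carrier M; y \<in> carrier N\<rbrakk> \<Longrightarrow> f x y \<in> carrier P"
    and "\<And>x x' y. \<lbrakk>x \<in> carrier M; x' \<in> carrier M; y \<in> carrier N\<rbrakk>
      \<Longrightarrow> f (x \<oplus>\<^bsub>M\<^esub> x') y = f x y \<oplus>\<^bsub>P\<^esub> f x' y"
    and "\<And>x y y'. \<lbrakk>x \<in> carrier M; y \<in> carrier N; y' \<in> carrier N\<rbrakk>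
      \<Longrightarrow> f x (y \<oplus>\<^bsub>N\<^esub> y') = f x y \<oplus>\<^bsub>P\<^esub> f x y'"
    and "\<And>a x y. \<lbrakk>a \<in> carrier K; x \<in> carrier M; y \<in> carrier N\<rbrakk> \<Longrightarrow> f (a \<odot>\<^bsub>M\<^esub> x) y = a \<odot>\<^bsub>P\<^esub> f x y"
    and "\<And>a x y. \<lbrakk>a \<in> carrier K; x \<in> carrier M; y \<in> carrier N\<rbrakk> \<Longrightarrow> f x (a \<odot>\<^bsub>N\<^esub> y) = a \<odot>\<^bsub>P\<^esub> f x y"
  shows "bilinear_map K M N P f"
  using assms by (auto simp: bilinear_map_def linear_map_def)

lemma bilinear_mapD:
  assumes "bilinear_map K M N P f"
  shows "\<lbrakk>x \<in> carrier M; y \<in> carrier N\<rbrakk> \<Longrightarrow> f x y \<in> carrier P"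
    and "\<lbrakk>x \<in> carrier M; x' \<in> carrier M; y \<in> carrier N\<rbrakk> \<Longrightarrow> f (x \<oplus>\<^bsub>M\<^esub> x') y = f x y \<oplus>\<^bsub>P\<^esub> f x' y"
    and "\<lbrakk>x \<in> carrier M; y \<in> carrier N; y' \<in> carrier N\<rbrakk> \<Longrightarrow> f x (y \<oplus>\<^bsub>N\<^esub> y') = f x y \<oplus>\<^bsub>P\<^esub> f x y'"
    and "\<lbrakk>a \<in> carrier K; x \<in> carrier M; y \<in> carrier N\<rbrakk> \<Longrightarrow> f (a \<odot>\<^bsub>M\<^esub> x) y = a \<odot>\<^bsub>P\<^esub> f x y"
    and "\<lbrakk>a \<in> carrier K; x \<in> carrier M; y \<in> carrier N\<rbrakk> \<Longrightarrow> f x (a \<odot>\<^bsub>N\<^esub> y) = a \<odot>\<^bsub>P\<^esub> f x y"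
  using assms by (auto simp: bilinear_map_def linear_map_def)

context
  fixes K :: "('k, 'a) ring_scheme" and M :: "('k, 'm, 'b) module_scheme"
    and N :: "('k, 'n, 'c) module_scheme"
  assumes M: "module K M" and N: "module K N"
begin

interpretation M: module K M by (rule M)
interpretation N: module K N by (rule N)

abbreviation (input) free_MN where "free_MN \<equiv> free_space K (carrier M \<times> carrier N)"

interpretation F: module K free_MN
  by (rule free_space_module) (rule M.R.is_cring)

lemma tensor_relations_closed: "tensor_relations K M N \<subseteq> carrier free_MN"
  by (auto simp: tensor_relations_def Let_def intro!: F.minus_closed F.smult_closed F.a_closed
      free_gen_closed M.R.is_cring)

lemmas tensor_span = submodule_span_properties[OF F.module_axioms tensor_relations_closed]

lemma tensor_space_module: "module K (tensor_space K M N)"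
  unfolding tensor_space_def Let_def
  by (rule quotient_space_module[OF F.module_axioms tensor_span(1)])

text \<open>Cosets agree as soon as their representatives differ by an element of the span, and for
  each bilinearity law that difference is one of the \<open>tensor_relations\<close>.\<close>

lemma pure_tensor_bilinear:
  "bilinear_map K M N (tensor_space K M N) (pure_tensor K M N)"
proof -
  let ?e = "\<lambda>x y. free_gen K (carrier M \<times> carrier N) (x, y)"
  note Q = F.module_axioms tensor_span(1)
  have e: "?e x y \<in> carrier free_MN" if "x \<in> carrier M" "y \<in> carrier N" for x y
    using that by (intro free_gen_closed M.R.is_cring) auto
  have rel: "r \<in> submodule_span K free_MN (tensor_relations K M N)"
    if "r \<in> tensor_relations K M N" for r
    using that tensor_span(2) by blast
  show ?thesis
    by (rule bilinear_mapI)
      (auto simp: tensor_space_def pure_tensor_def Let_def quotient_space_carrier[OF Q]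
        quotient_space_add[OF Q] quotient_space_smult[OF Q] quotient_space_coset_eq[OF Q] e
        intro!: rel, auto simp: tensor_relations_def Let_def)
qed

text \<open>Inherited from induction on the free space by passing to cosets. A case for zero is
  avoided, which keeps the nested inductions for the algebraic identities short.\<close>

lemma tensor_induct [consumes 1, case_names pure add smult]:
  assumes z: "z \<in> carrier (tensor_space K M N)"
    and pure: "\<And>x y. \<lbrakk>x \<in> carrier M; y \<in> carrier N\<rbrakk> \<Longrightarrow> P (pure_tensor K M N x y)"
    and add: "\<And>z w. \<lbrakk>z \<in> carrier (tensor_space K M N); w \<in> carrier (tensor_space K M N); P z; P w\<rbrakk>
      \<Longrightarrow> P (z \<oplus>\<^bsub>tensor_space K M N\<^esub> w)"
    and smult: "\<And>a z. \<lbrakk>a \<in> carrier K; z \<in> carrier (tensor_space K M N); P z\<rbrakk>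
      \<Longrightarrow> P (a \<odot>\<^bsub>tensor_space K M N\<^esub> z)"
  shows "P z"
proof -
  note Q = F.module_axioms tensor_span(1)
  let ?H = "submodule_span K free_MN (tensor_relations K M N)"
  interpret T: module K "tensor_space K M N" by (rule tensor_space_module)
  \<comment> \<open>The zero tensor is the scalar zero times the pure tensor of two zeros.\<close>
  have "P \<zero>\<^bsub>tensor_space K M N\<^esub>"
    using smult[OF M.R.zero_closed _ pure[OF M.zero_closed N.zero_closed]]
      bilinear_mapD(1)[OF pure_tensor_bilinear M.zero_closed N.zero_closed] by simp
  then have P_zero: "P (?H +>\<^bsub>free_MN\<^esub> \<zero>\<^bsub>free_MN\<^esub>)"
    by (simp add: tensor_space_def Let_def quotient_space_zero[OF Q])
  have "P (?H +>\<^bsub>free_MN\<^esub> f)" if "f \<in> carrier free_MN" for f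
    using M.R.is_cring that
  proof (induction rule: free_space_induct)
    case zero
    show ?case by (rule P_zero)
  next
    case (gen p)
    then show ?case using pure[of "fst p" "snd p"] by (auto simp: pure_tensor_def Let_def)
  next
    case (add f g)
    then show ?case
      using assms(3)[of "?H +>\<^bsub>free_MN\<^esub> f" "?H +>\<^bsub>free_MN\<^esub> g"]
      by (auto simp: tensor_space_def Let_def quotient_space_carrier[OF Q] quotient_space_add[OF Q])
  next
    case (smult a f)
    then show ?case
      using assms(4)[of a "?H +>\<^bsub>free_MN\<^esub> f"]
      by (auto simp: tensor_space_def Let_def quotient_space_carrier[OF Q] quotient_space_smult[OF Q])
  qed
  then show ?thesis
    using z by (auto simp: tensor_space_def Let_def quotient_space_carrier[OF Q])
qed

lemma tensor_lift:
  assumes P: "module K P" and f: "bilinear_map K M N P f"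
  shows "\<exists>h. linear_map K (tensor_space K M N) P h \<and>
    (\<forall>x\<in>carrier M. \<forall>y\<in>carrier N. h (pure_tensor K M N x y) = f x y)"
proof -
  interpret P: module K P by (rule P)
  note f = bilinear_mapD[OF f]
  let ?e = "\<lambda>x y. free_gen K (carrier M \<times> carrier N) (x, y)"
  have e: "?e x y \<in> carrier free_MN" if "x \<in> carrier M" "y \<in> carrier N" for x y
    using that by (intro free_gen_closed M.R.is_cring) auto
  have "(\<lambda>(x, y). f x y) \<in> carrier M \<times> carrier N \<rightarrow> carrier P"
    using f(1) by auto
  from free_space_lift[OF P this] obtain g where g: "linear_map K free_MN P g"
    and g_gen: "\<And>x y. \<lbrakk>x \<in> carrier M; y \<in> carrier N\<rbrakk> \<Longrightarrow> g (?e x y) = f x y"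
    by auto
  note lin = linear_mapD[OF g] linear_map_zero_minus[OF F.module_axioms P g]
  \<comment> \<open>\<open>g\<close> must vanish on a span that is only known as an intersection of
    submodules. Its kernel is one of the submodules containing the relations, so it contains the
    span.\<close>
  let ?ker = "{u \<in> carrier free_MN. g u = \<zero>\<^bsub>P\<^esub>}"
  have "submodule ?ker K free_MN"
  proof (rule F.submoduleI)
    fix u assume "u \<in> ?ker"
    then show "\<ominus>\<^bsub>free_MN\<^esub> u \<in> ?ker"
      using lin(5)[of "\<zero>\<^bsub>free_MN\<^esub>" u] lin(4) by (simp add: F.minus_eq P.minus_eq)
  qed (auto simp: lin)
  moreover have "g r = \<zero>\<^bsub>P\<^esub>" if "r \<in> tensor_relations K M N" for r
    using that unfolding tensor_relations_def Let_def
    by (elim UnE CollectE exE conjE) (simp_all add: lin e g_gen f P.r_neg P.minus_eq)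
  then have "tensor_relations K M N \<subseteq> ?ker"
    using tensor_relations_closed by blast
  ultimately have "g u = \<zero>\<^bsub>P\<^esub>" if "u \<in> submodule_span K free_MN (tensor_relations K M N)" for u
    using tensor_span(3) that by blast
  from quotient_space_lift[OF F.module_axioms tensor_span(1) P g this] obtain h
    where "linear_map K (tensor_space K M N) P h"
      and "\<And>u. u \<in> carrier free_MN
        \<Longrightarrow> h (submodule_span K free_MN (tensor_relations K M N) +>\<^bsub>free_MN\<^esub> u) = g u"
    by (auto simp: tensor_space_def Let_def)
  then show ?thesis
    by (intro exI[of _ h]) (simp add: pure_tensor_def Let_def e g_gen)
qed

lemma tensor_linear_ext:
  assumes "linear_map K (tensor_space K M N) P f" "linear_map K (tensor_space K M N) P g"
    and "\<And>x y. \<lbrakk>x \<in> carrier M; y \<in> carrier N\<rbrakk>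
      \<Longrightarrow> f (pure_tensor K M N x y) = g (pure_tensor K M N x y)"
    and "z \<in> carrier (tensor_space K M N)"
  shows "f z = g z"
  using assms(4) by (induction rule: tensor_induct) (simp_all add: assms(3) linear_mapD[OF assms(1)] linear_mapD[OF assms(2)])

end

text \<open>For existence, \<open>f\<close> is curried to a bilinear map into
  \<open>Hom(P, Q)\<close> and lifted. For uniqueness, with \<open>p\<close> fixed both candidates
  are linear in the tensor and agree on pure ones; extensionality in both arguments then gives
  equality of functions.\<close>

lemma tensor_extend_trilinear:
  assumes M: "module K M" and N: "module K N" and P: "module K P" and Q: "module K Q"
    and f: "trilinear_map K M N P Q f"
  shows "\<exists>!\<beta>. \<beta> \<in> carrier (tensor_space K M N) \<rightarrow>\<^sub>E carrier P \<rightarrow>\<^sub>E carrier Q \<and>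
    bilinear_map K (tensor_space K M N) P Q \<beta> \<and>
    (\<forall>x\<in>carrier M. \<forall>y\<in>carrier N. \<forall>p\<in>carrier P. \<beta> (pure_tensor K M N x y) p = f x y p)"
proof (rule ex_ex1I)
  let ?L = "tensor_space K M N" and ?H = "hom_space K P Q"
  interpret M: module K M by fact
  interpret N: module K N by fact
  interpret P: module K P by fact
  interpret Q: module K Q by fact
  interpret L: module K ?L by (rule tensor_space_module[OF M N])
  have H: "module K ?H" by (rule hom_space_module[OF P Q])
  interpret H: module K ?H by (rule H)
  let ?f = "\<lambda>x y. \<lambda>p\<in>carrier P. f x y p"
  have f_hom: "?f x y \<in> carrier ?H" if "x \<in> carrier M" "y \<in> carrier N" for x y
    using that f by (intro hom_space_restrict P) (auto simp: trilinear_map_def)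
  have "bilinear_map K M N ?H ?f"
    by (rule bilinear_mapI)
      (use f in \<open>auto intro!: hom_space_ext[of _ K P Q] f_hom
        simp: hom_space_apply trilinear_map_def linear_map_def\<close>)
  from tensor_lift[OF M N H this] obtain h where h: "linear_map K ?L ?H h"
    and h_pure: "\<And>x y. \<lbrakk>x \<in> carrier M; y \<in> carrier N\<rbrakk> \<Longrightarrow> h (pure_tensor K M N x y) = ?f x y"
    by blast
  have hz: "linear_map K P Q (h z)" "h z \<in> extensional (carrier P)" if "z \<in> carrier ?L" for z
    using linear_mapD(1)[OF h that] by (auto simp: hom_space_def)
  \<comment> \<open>Values of \<open>h\<close> on the carrier are already extensional in
    \<open>p\<close>; the restriction adds extensionality in the tensor argument.\<close>
  let ?\<beta> = "\<lambda>z\<in>carrier ?L. h z"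
  have "bilinear_map K ?L P Q ?\<beta>"
    by (rule bilinear_mapI)
      (use linear_mapD[OF hz(1)] in \<open>auto simp: linear_mapD(2,3)[OF h] hom_space_apply\<close>)
  moreover have "?\<beta> \<in> carrier ?L \<rightarrow>\<^sub>E carrier P \<rightarrow>\<^sub>E carrier Q"
    using hz linear_mapD(1)[OF hz(1)] by (auto simp: PiE_iff)
  ultimately show "\<exists>\<beta>. \<beta> \<in> carrier ?L \<rightarrow>\<^sub>E carrier P \<rightarrow>\<^sub>E carrier Q \<and> bilinear_map K ?L P Q \<beta> \<and>
      (\<forall>x\<in>carrier M. \<forall>y\<in>carrier N. \<forall>p\<in>carrier P. \<beta> (pure_tensor K M N x y) p = f x y p)"
    using h_pure bilinear_mapD(1)[OF pure_tensor_bilinear[OF M N]]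
    by (intro exI[of _ ?\<beta>]) auto
next
  let ?L = "tensor_space K M N"
  fix \<beta> \<gamma>
  assume \<beta>: "\<beta> \<in> carrier ?L \<rightarrow>\<^sub>E carrier P \<rightarrow>\<^sub>E carrier Q \<and> bilinear_map K ?L P Q \<beta> \<and>
      (\<forall>x\<in>carrier M. \<forall>y\<in>carrier N. \<forall>p\<in>carrier P. \<beta> (pure_tensor K M N x y) p = f x y p)"
    and \<gamma>: "\<gamma> \<in> carrier ?L \<rightarrow>\<^sub>E carrier P \<rightarrow>\<^sub>E carrier Q \<and> bilinear_map K ?L P Q \<gamma> \<and>
      (\<forall>x\<in>carrier M. \<forall>y\<in>carrier N. \<forall>p\<in>carrier P. \<gamma> (pure_tensor K M N x y) p = f x y p)"
  have "\<beta> z p = \<gamma> z p" if "z \<in> carrier ?L" "p \<in> carrier P" for z p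
    by (rule tensor_linear_ext[OF M N _ _ _ that(1), of Q "\<lambda>z. \<beta> z p" "\<lambda>z. \<gamma> z p"])
      (use \<beta> \<gamma> that(2) in \<open>auto simp: bilinear_map_def\<close>)
  then show "\<beta> = \<gamma>"
    using \<beta> \<gamma> by (intro PiE_ext[of _ "carrier ?L" "\<lambda>_. carrier P \<rightarrow>\<^sub>E carrier Q"] PiE_ext[of _ "carrier P"]) auto
qed

section \<open>The Leibniz algebra of a Lie triple system\<close>

lemma trilinear_mapI:
  assumes "\<And>x y z. \<lbrakk>x \<in> carrier M; y \<in> carrier N; z \<in> carrier P\<rbrakk> \<Longrightarrow> f x y z \<in> carrier Q"
    and "\<And>x x' y z. \<lbrakk>x \<in> carrier M; x' \<in> carrier M; y \<in> carrier N; z \<in> carrier P\<rbrakk>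
      \<Longrightarrow> f (x \<oplus>\<^bsub>M\<^esub> x') y z = f x y z \<oplus>\<^bsub>Q\<^esub> f x' y z"
    and "\<And>x y y' z. \<lbrakk>x \<in> carrier M; y \<in> carrier N; y' \<in> carrier N; z \<in> carrier P\<rbrakk>
      \<Longrightarrow> f x (y \<oplus>\<^bsub>N\<^esub> y') z = f x y z \<oplus>\<^bsub>Q\<^esub> f x y' z"
    and "\<And>x y z z'. \<lbrakk>x \<in> carrier M; y \<in> carrier N; z \<in> carrier P; z' \<in> carrier P\<rbrakk>
      \<Longrightarrow> f x y (z \<oplus>\<^bsub>P\<^esub> z') = f x y z \<oplus>\<^bsub>Q\<^esub> f x y z'"
    and "\<And>a x y z. \<lbrakk>a \<in> carrier K; x \<in> carrier M; y \<in> carrier N; z \<in> carrier P\<rbrakk>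
      \<Longrightarrow> f (a \<odot>\<^bsub>M\<^esub> x) y z = a \<odot>\<^bsub>Q\<^esub> f x y z"
    and "\<And>a x y z. \<lbrakk>a \<in> carrier K; x \<in> carrier M; y \<in> carrier N; z \<in> carrier P\<rbrakk>
      \<Longrightarrow> f x (a \<odot>\<^bsub>N\<^esub> y) z = a \<odot>\<^bsub>Q\<^esub> f x y z"
    and "\<And>a x y z. \<lbrakk>a \<in> carrier K; x \<in> carrier M; y \<in> carrier N; z \<in> carrier P\<rbrakk>
      \<Longrightarrow> f x y (a \<odot>\<^bsub>P\<^esub> z) = a \<odot>\<^bsub>Q\<^esub> f x y z"
  shows "trilinear_map K M N P Q f"
  using assms by (auto simp: trilinear_map_def linear_map_def Pi_iff)

lemma trilinear_mapD:
  assumes "trilinear_map K M N P Q f"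
    and "x \<in> carrier M" "y \<in> carrier N" "z \<in> carrier P"
  shows "f x y z \<in> carrier Q"
    and "x' \<in> carrier M \<Longrightarrow> f (x \<oplus>\<^bsub>M\<^esub> x') y z = f x y z \<oplus>\<^bsub>Q\<^esub> f x' y z"
    and "y' \<in> carrier N \<Longrightarrow> f x (y \<oplus>\<^bsub>N\<^esub> y') z = f x y z \<oplus>\<^bsub>Q\<^esub> f x y' z"
    and "z' \<in> carrier P \<Longrightarrow> f x y (z \<oplus>\<^bsub>P\<^esub> z') = f x y z \<oplus>\<^bsub>Q\<^esub> f x y z'"
    and "a \<in> carrier K \<Longrightarrow> f (a \<odot>\<^bsub>M\<^esub> x) y z = a \<odot>\<^bsub>Q\<^esub> f x y z"
    and "a \<in> carrier K \<Longrightarrow> f x (a \<odot>\<^bsub>N\<^esub> y) z = a \<odot>\<^bsub>Q\<^esub> f x y z"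
    and "a \<in> carrier K \<Longrightarrow> f x y (a \<odot>\<^bsub>P\<^esub> z) = a \<odot>\<^bsub>Q\<^esub> f x y z"
  using assms by (auto simp: trilinear_map_def linear_map_def Pi_iff)

context lie_triple_system begin

abbreviation "L \<equiv> tensor_square K T"
abbreviation "tn \<equiv> tens K T"
abbreviation "mul \<equiv> lts_product K T br"

sublocale L: module K L
  by (rule tensor_space_module[OF module_axioms module_axioms])

lemmas tens_simps = bilinear_mapD[OF pure_tensor_bilinear[OF module_axioms module_axioms]]
lemmas tens_closed [simp] = tens_simps(1)
lemmas br_simps [simp] = trilinear_mapD[OF br_trilinear]

text \<open>With \<open>d = br x y\<close> this is the operator
  \<open>d \<otimes> 1 + 1 \<otimes> d\<close>, the extension of \<open>d\<close> to tensors by the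
  Leibniz rule.\<close>

lemma pure_action_bilinear:
  assumes "x \<in> carrier T" "y \<in> carrier T"
  shows "bilinear_map K T T L (\<lambda>u v. tn (br x y u) v \<oplus>\<^bsub>L\<^esub> tn u (br x y v))"
  by (rule bilinear_mapI) (use assms in \<open>simp_all add: tens_simps L.a_ac L.smult_r_distr\<close>)

text \<open>The extension takes two stages: with \<open>x\<close> and \<open>y\<close> fixed, the
  operator \<open>A x y\<close> extends to all tensors in the right factor; its dependence on
  \<open>x\<close> and \<open>y\<close> is then extended to the left factor.\<close>

lemma ex1_lts_product: "\<exists>!m. is_lts_product K T br m"
proof -
  note T = module_axioms
  note ext = tensor_linear_ext[OF T T]
  note combs = linear_map_combinations[OF L.module_axioms L.module_axioms]
  have "\<exists>h. linear_map K L L h \<and>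
      (\<forall>u\<in>carrier T. \<forall>v\<in>carrier T. h (tn u v) = tn (br x y u) v \<oplus>\<^bsub>L\<^esub> tn u (br x y v))"
    if "x \<in> carrier T" "y \<in> carrier T" for x y
    by (rule tensor_lift[OF T T L.module_axioms pure_action_bilinear[OF that]])
  then obtain A where A: "\<And>x y. \<lbrakk>x \<in> carrier T; y \<in> carrier T\<rbrakk> \<Longrightarrow> linear_map K L L (A x y)"
    and A_pure: "\<And>x y u v. \<lbrakk>x \<in> carrier T; y \<in> carrier T; u \<in> carrier T; v \<in> carrier T\<rbrakk>
      \<Longrightarrow> A x y (tn u v) = tn (br x y u) v \<oplus>\<^bsub>L\<^esub> tn u (br x y v)"
    by metis
  \<comment> \<open>The operators were chosen separately for each pair, so linearity in
    \<open>x\<close> and \<open>y\<close> is not built in. It follows from uniqueness, as both sides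
    are linear in \<open>z\<close> and agree on pure tensors.\<close>
  have "trilinear_map K T T L L A"
  proof (rule trilinear_mapI)
    fix x x' y z
    assume xyz: "x \<in> carrier T" "x' \<in> carrier T" "y \<in> carrier T" "z \<in> carrier L"
    show "A (x \<oplus>\<^bsub>T\<^esub> x') y z = A x y z \<oplus>\<^bsub>L\<^esub> A x' y z"
      by (rule ext[where P = L, OF _ _ _ xyz(4)])
        (use xyz in \<open>simp_all add: A A_pure combs tens_simps L.a_ac\<close>)
  next
    fix x y y' z
    assume xyz: "x \<in> carrier T" "y \<in> carrier T" "y' \<in> carrier T" "z \<in> carrier L"
    show "A x (y \<oplus>\<^bsub>T\<^esub> y') z = A x y z \<oplus>\<^bsub>L\<^esub> A x y' z"
      by (rule ext[where P = L, OF _ _ _ xyz(4)])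
        (use xyz in \<open>simp_all add: A A_pure combs tens_simps L.a_ac\<close>)
  next
    fix a x y z
    assume xyz: "a \<in> carrier K" "x \<in> carrier T" "y \<in> carrier T" "z \<in> carrier L"
    show "A (a \<odot>\<^bsub>T\<^esub> x) y z = a \<odot>\<^bsub>L\<^esub> A x y z"
      by (rule ext[where P = L, OF _ _ _ xyz(4)])
        (use xyz in \<open>simp_all add: A A_pure combs tens_simps L.smult_r_distr\<close>)
    show "A x (a \<odot>\<^bsub>T\<^esub> y) z = a \<odot>\<^bsub>L\<^esub> A x y z"
      by (rule ext[where P = L, OF _ _ _ xyz(4)])
        (use xyz in \<open>simp_all add: A A_pure combs tens_simps L.smult_r_distr\<close>)
  qed (auto simp: linear_mapD[OF A])
  note ex1 = tensor_extend_trilinear[OF T T L.module_axioms L.module_axioms this]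
  \<comment> \<open>The predicate fixes \<open>m\<close> on pairs of pure tensors, the extension
    result on a pure first factor and arbitrary second one; linearity in the second factor makes
    these equivalent.\<close>
  have "is_lts_product K T br m \<longleftrightarrow>
      m \<in> carrier L \<rightarrow>\<^sub>E carrier L \<rightarrow>\<^sub>E carrier L \<and> bilinear_map K L L L m \<and>
      (\<forall>x\<in>carrier T. \<forall>y\<in>carrier T. \<forall>z\<in>carrier L. m (tn x y) z = A x y z)" for m
  proof -
    have "m (tn x y) z = A x y z"
      if m: "bilinear_map K L L L m" "\<forall>x1\<in>carrier T. \<forall>x2\<in>carrier T. \<forall>y1\<in>carrier T. \<forall>y2\<in>carrier T.
         m (tn x1 x2) (tn y1 y2) = tn (br x1 x2 y1) y2 \<oplus>\<^bsub>L\<^esub> tn y1 (br x1 x2 y2)"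
        and x: "x \<in> carrier T" and y: "y \<in> carrier T" and z: "z \<in> carrier L" for x y z
      by (rule ext[where P = L, OF _ _ _ z])
        (use m x y in \<open>simp_all add: A A_pure bilinear_map_def\<close>)
    then show ?thesis
      unfolding is_lts_product_def Let_def by (auto simp: A_pure)
  qed
  with ex1 show ?thesis by simp
qed

lemma lts_product: "is_lts_product K T br mul"
  unfolding lts_product_def by (rule theI'[OF ex1_lts_product])

lemma mul_simps [simp]:
  shows mul_bilinear: "bilinear_map K L L L mul"
    and "\<lbrakk>x1 \<in> carrier T; x2 \<in> carrier T; y1 \<in> carrier T; y2 \<in> carrier T\<rbrakk> \<Longrightarrow>
      mul (tn x1 x2) (tn y1 y2) = tn (br x1 x2 y1) y2 \<oplus>\<^bsub>L\<^esub> tn y1 (br x1 x2 y2)"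
  using lts_product by (auto simp: is_lts_product_def Let_def)

lemma lts_leibniz_algebra: "leibniz_algebra K L mul"
proof (intro leibniz_algebra.intro leibniz_algebra_axioms.intro field_axioms L.module_axioms mul_bilinear)
  note mul = bilinear_mapD[OF mul_bilinear]
  note tind = tensor_induct[OF module_axioms module_axioms, consumes 1, case_names pure add smult]
  fix x y z assume x: "x \<in> carrier L" and y: "y \<in> carrier L" and z: "z \<in> carrier L"
  show "mul x (mul y z) = mul (mul x y) z \<oplus>\<^bsub>L\<^esub> mul y (mul x z)"
    using x
  proof (induction rule: tind)
    case x: (pure x1 x2)
    show ?case
      using y
    proof (induction rule: tind)
      case y: (pure y1 y2)
      show ?case
        using z
      proof (induction rule: tind)
        case z: (pure z1 z2)
        \<comment> \<open>The mixed terms, where one operator acts on each factor, occur on both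
          sides and cancel. On a single factor, \<open>br_derivation\<close> says that the
          commutator of the operators of \<open>x\<close> and \<open>y\<close> is the operator of
          their product.\<close>
        with x y show ?case by (simp add: mul tens_simps br_derivation[of x1 x2 y1 y2] L.a_ac)
      next
        case (add z w)
        with x y show ?case by (simp add: mul L.a_ac)
      next
        case (smult a z)
        with x y show ?case by (simp add: mul L.smult_r_distr)
      qed
    next
      case (add y y')
      with x z show ?case by (simp add: mul L.a_ac)
    next
      case (smult a y)
      with x z show ?case by (simp add: mul L.smult_r_distr)
    qed
  next
    case (add x x')
    with y z show ?case by (simp add: mul L.a_ac)
  next
    case (smult a x)
    with y z show ?case by (simp add: mul L.smult_r_distr)
  qed
qed

end

section \<open>The representation on \<open>Hom(T, V)\<close>\<close>

context lts_representation begin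

abbreviation "H \<equiv> hom_space K T V"
abbreviation "th x y \<equiv> \<theta> (tn x y)"
abbreviation "D \<equiv> D_op K T V \<theta>"

sublocale E: module K "end_space K V"
  by (rule hom_space_module[OF rep.module_axioms rep.module_axioms])

sublocale H: module K H
  by (rule hom_space_module[OF module_axioms rep.module_axioms])

section \<open>(R1) and (R2) evaluated at vectors\<close>

lemma th_closed [simp]: "\<lbrakk>x \<in> carrier T; y \<in> carrier T\<rbrakk> \<Longrightarrow> th x y \<in> carrier (end_space K V)"
  by (simp add: linear_mapD(1)[OF theta_linear])

lemma D_closed [simp]: "\<lbrakk>x \<in> carrier T; y \<in> carrier T\<rbrakk> \<Longrightarrow> D x y \<in> carrier (end_space K V)"
  by (simp add: D_op_def)

lemma D_apply:
  "\<lbrakk>x \<in> carrier T; y \<in> carrier T; v \<in> carrier V\<rbrakk> \<Longrightarrow> D x y v = th y x v \<ominus>\<^bsub>V\<^esub> th x y v"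
  by (simp add: D_op_def hom_space_minus_apply[OF rep.module_axioms rep.module_axioms])

lemma end_space_simps:
  assumes "f \<in> carrier (end_space K V)" "v \<in> carrier V"
  shows "f v \<in> carrier V"
    and "w \<in> carrier V \<Longrightarrow> f (v \<oplus>\<^bsub>V\<^esub> w) = f v \<oplus>\<^bsub>V\<^esub> f w"
    and "w \<in> carrier V \<Longrightarrow> f (v \<ominus>\<^bsub>V\<^esub> w) = f v \<ominus>\<^bsub>V\<^esub> f w"
    and "a \<in> carrier K \<Longrightarrow> f (a \<odot>\<^bsub>V\<^esub> v) = a \<odot>\<^bsub>V\<^esub> f v"
  using assms linear_mapD[OF hom_spaceD(1)[OF assms(1)]]
    linear_map_zero_minus(2)[OF rep.module_axioms rep.module_axioms hom_spaceD(1)[OF assms(1)]]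
  by auto

text \<open>Counting the vector as a third argument puts \<open>th\<close> and \<open>D\<close>
  under the same rewrite rules as \<open>br\<close>.\<close>

lemma th_trilinear: "trilinear_map K T T V V th"
  by (rule trilinear_mapI)
    (simp_all add: end_space_simps tens_simps linear_mapD(2,3)[OF theta_linear] hom_space_apply)

lemma D_trilinear: "trilinear_map K T T V V D"
  by (rule trilinear_mapI)
    (simp_all add: D_apply trilinear_mapD[OF th_trilinear] rep.M.diff_add_diff rep.smult_diff)

lemmas action_simps [simp] = trilinear_mapD[OF th_trilinear] trilinear_mapD[OF D_trilinear]
  end_space_simps(3)[OF th_closed] end_space_simps(3)[OF D_closed]

lemma end_compose:
  assumes "f \<in> carrier (end_space K V)" "g \<in> carrier (end_space K V)"
  shows "compose (carrier V) f g \<in> carrier (end_space K V)"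
  unfolding compose_def
  by (rule hom_space_restrict[OF rep.module_axioms
        linear_map_comp[OF hom_spaceD(1)[OF assms(2)] hom_spaceD(1)[OF assms(1)]]])

text \<open>This is (R1) at \<open>v\<close> with the product expanded: moving
  \<open>D x1 x2\<close> past \<theta> costs its action on each argument of \<theta>.\<close>

lemma D_th:
  assumes "x1 \<in> carrier T" "x2 \<in> carrier T" "y1 \<in> carrier T" "y2 \<in> carrier T" "v \<in> carrier V"
  shows "D x1 x2 (th y1 y2 v) =
    th y1 y2 (D x1 x2 v) \<oplus>\<^bsub>V\<^esub> th (br x1 x2 y1) y2 v \<oplus>\<^bsub>V\<^esub> th y1 (br x1 x2 y2) v"
proof -
  have "D x1 x2 (th y1 y2 v) \<ominus>\<^bsub>V\<^esub> th y1 y2 (D x1 x2 v) = \<theta> (mul (tn x1 x2) (tn y1 y2)) v"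
    using arg_cong[OF R1[OF assms(1-4)], of "\<lambda>f. f v"]
      hom_space_minus_apply[OF rep.module_axioms rep.module_axioms assms(5) end_compose end_compose,
        OF D_closed[OF assms(1,2)] th_closed[OF assms(3,4)] th_closed[OF assms(3,4)] D_closed[OF assms(1,2)]]
    by (simp only: compose_eq[OF assms(5)])
  then show ?thesis
    using assms by (simp add: linear_mapD(2)[OF theta_linear] hom_space_apply rep.M.diff_simps rep.M.a_ac)
qed

lemma th_br:
  assumes "x \<in> carrier T" "y1 \<in> carrier T" "y2 \<in> carrier T" "y3 \<in> carrier T" "v \<in> carrier V"
  shows "th x (br y1 y2 y3) v =
    (th y2 y3 (th x y1 v) \<ominus>\<^bsub>V\<^esub> th y1 y3 (th x y2 v)) \<oplus>\<^bsub>V\<^esub> D y1 y2 (th x y3 v)"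
proof -
  show ?thesis
    unfolding R2[OF assms(1-4)] using assms
    by (simp add: end_compose compose_eq hom_space_apply hom_space_minus_apply[OF rep.module_axioms rep.module_axioms])
qed

text \<open>\<open>D\<close> is \<theta> antisymmetrized in its two arguments, so
  \<open>D_th\<close> is applied to both orders and the terms are regrouped.\<close>

lemma D_D:
  assumes "x1 \<in> carrier T" "x2 \<in> carrier T" "y1 \<in> carrier T" "y2 \<in> carrier T" "v \<in> carrier V"
  shows "D x1 x2 (D y1 y2 v) =
    D y1 y2 (D x1 x2 v) \<oplus>\<^bsub>V\<^esub> D (br x1 x2 y1) y2 v \<oplus>\<^bsub>V\<^esub> D y1 (br x1 x2 y2) v"
proof -
  \<comment> \<open>Naming this vector keeps it intact when \<open>D_apply\<close> rewrites the
    other occurrences of \<open>D\<close>.\<close>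
  define w where "w = D x1 x2 v"
  have w: "w \<in> carrier V" using assms by (simp add: w_def)
  have "D x1 x2 (D y1 y2 v) = D x1 x2 (th y2 y1 v) \<ominus>\<^bsub>V\<^esub> D x1 x2 (th y1 y2 v)"
    using assms by (simp only: D_apply[of y1 y2] action_simps)
  also have "\<dots> = (th y2 y1 w \<oplus>\<^bsub>V\<^esub> th (br x1 x2 y2) y1 v \<oplus>\<^bsub>V\<^esub> th y2 (br x1 x2 y1) v)
      \<ominus>\<^bsub>V\<^esub> (th y1 y2 w \<oplus>\<^bsub>V\<^esub> th (br x1 x2 y1) y2 v \<oplus>\<^bsub>V\<^esub> th y1 (br x1 x2 y2) v)"
    using assms by (simp only: D_th w_def)
  also have "\<dots> = (th y2 y1 w \<ominus>\<^bsub>V\<^esub> th y1 y2 w)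
      \<oplus>\<^bsub>V\<^esub> (th y2 (br x1 x2 y1) v \<ominus>\<^bsub>V\<^esub> th (br x1 x2 y1) y2 v)
      \<oplus>\<^bsub>V\<^esub> (th (br x1 x2 y2) y1 v \<ominus>\<^bsub>V\<^esub> th y1 (br x1 x2 y2) v)"
    using assms w by (simp add: rep.M.diff_simps rep.M.a_ac)
  also have "\<dots> = D y1 y2 w \<oplus>\<^bsub>V\<^esub> D (br x1 x2 y1) y2 v \<oplus>\<^bsub>V\<^esub> D y1 (br x1 x2 y2) v"
    using assms w by (simp only: D_apply br_simps)
  finally show ?thesis by (simp only: w_def)
qed

section \<open>The two actions on Hom(T, V)\<close>

lemma H_simps [simp]:
  assumes "\<phi> \<in> carrier H" "x \<in> carrier T"
  shows "\<phi> x \<in> carrier V"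
    and "y \<in> carrier T \<Longrightarrow> \<phi> (x \<oplus>\<^bsub>T\<^esub> y) = \<phi> x \<oplus>\<^bsub>V\<^esub> \<phi> y"
    and "a \<in> carrier K \<Longrightarrow> \<phi> (a \<odot>\<^bsub>T\<^esub> x) = a \<odot>\<^bsub>V\<^esub> \<phi> x"
  using assms linear_mapD[OF hom_spaceD(1)[OF assms(1)]] by auto

definition left_form where
  "left_form x1 x2 \<phi> = (\<lambda>x3\<in>carrier T. D x1 x2 (\<phi> x3) \<ominus>\<^bsub>V\<^esub> \<phi> (br x1 x2 x3))"

text \<open>This is the negative of \<open>left_form\<close> plus a \<theta>-term; the sum of the
  two actions therefore keeps only the \<theta>-term.\<close>

definition right_form where
  "right_form x1 x2 \<phi> = (\<lambda>x3\<in>carrier T. \<phi> (br x1 x2 x3) \<ominus>\<^bsub>V\<^esub> D x1 x2 (\<phi> x3)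
     \<oplus>\<^bsub>V\<^esub> th x1 x3 (\<phi> x2) \<ominus>\<^bsub>V\<^esub> th x2 x3 (\<phi> x1))"

lemma forms_closed:
  assumes "x1 \<in> carrier T" "x2 \<in> carrier T" "\<phi> \<in> carrier H"
  shows "left_form x1 x2 \<phi> \<in> carrier H" and "right_form x1 x2 \<phi> \<in> carrier H"
  using assms
  by (auto simp: left_form_def right_form_def linear_map_def
      rep.M.diff_simps rep.M.a_ac rep.smult_diff rep.smult_r_distr
      intro!: hom_space_restrict module_axioms)

lemma forms_apply:
  assumes "x3 \<in> carrier T"
  shows "left_form x1 x2 \<phi> x3 = D x1 x2 (\<phi> x3) \<ominus>\<^bsub>V\<^esub> \<phi> (br x1 x2 x3)"
    and "right_form x1 x2 \<phi> x3 = \<phi> (br x1 x2 x3) \<ominus>\<^bsub>V\<^esub> D x1 x2 (\<phi> x3)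
      \<oplus>\<^bsub>V\<^esub> th x1 x3 (\<phi> x2) \<ominus>\<^bsub>V\<^esub> th x2 x3 (\<phi> x1)"
  using assms by (simp_all add: left_form_def right_form_def)

lemma forms_trilinear:
  shows "trilinear_map K T T H H left_form" and "trilinear_map K T T H H right_form"
  by (rule trilinear_mapI;
      (rule hom_space_ext[of _ K T V])?,
      auto simp: forms_closed forms_apply hom_space_apply rep.M.diff_simps rep.M.a_ac
        rep.smult_diff rep.smult_r_distr)+

lemmas ex1_left_form =
  tensor_extend_trilinear[OF module_axioms module_axioms H.module_axioms H.module_axioms forms_trilinear(1)]

lemmas ex1_right_form =
  tensor_extend_trilinear[OF module_axioms module_axioms H.module_axioms H.module_axioms forms_trilinear(2)]

text \<open>Turns the condition at each \<open>x3\<close> into an equation in \<open>H\<close>, the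
  shape that the extension result produces; both sides are extensional, so nothing is lost.\<close>

lemma is_hom_left_action_iff:
  "is_hom_left_action K T br V \<theta> lact \<longleftrightarrow>
     lact \<in> carrier L \<rightarrow>\<^sub>E carrier H \<rightarrow>\<^sub>E carrier H \<and> bilinear_map K L H H lact \<and>
     (\<forall>x1\<in>carrier T. \<forall>x2\<in>carrier T. \<forall>\<phi>\<in>carrier H. lact (tn x1 x2) \<phi> = left_form x1 x2 \<phi>)"
proof -
  have "lact (tn x1 x2) \<phi> = left_form x1 x2 \<phi> \<longleftrightarrow> (\<forall>x3\<in>carrier T.
      lact (tn x1 x2) \<phi> x3 = D x1 x2 (\<phi> x3) \<ominus>\<^bsub>V\<^esub> \<phi> (br x1 x2 x3))"
    if "bilinear_map K L H H lact" "x1 \<in> carrier T" "x2 \<in> carrier T" "\<phi> \<in> carrier H" for x1 x2 \<phi>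
    using hom_space_ext[OF bilinear_mapD(1)[OF that(1)] forms_closed(1)[OF that(2-4)]] that
    by (auto simp: left_form_def)
  then show ?thesis
    unfolding is_hom_left_action_def Let_def by auto
qed

lemma is_hom_right_action_iff:
  "is_hom_right_action K T br V \<theta> ract \<longleftrightarrow>
     ract \<in> carrier H \<rightarrow>\<^sub>E carrier L \<rightarrow>\<^sub>E carrier H \<and> bilinear_map K H L H ract \<and>
     (\<forall>x1\<in>carrier T. \<forall>x2\<in>carrier T. \<forall>\<phi>\<in>carrier H. ract \<phi> (tn x1 x2) = right_form x1 x2 \<phi>)"
proof -
  have "ract \<phi> (tn x1 x2) = right_form x1 x2 \<phi> \<longleftrightarrow> (\<forall>x3\<in>carrier T.
      ract \<phi> (tn x1 x2) x3 = \<phi> (br x1 x2 x3) \<ominus>\<^bsub>V\<^esub> D x1 x2 (\<phi> x3)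
             \<oplus>\<^bsub>V\<^esub> th x1 x3 (\<phi> x2) \<ominus>\<^bsub>V\<^esub> th x2 x3 (\<phi> x1))"
    if "bilinear_map K H L H ract" "x1 \<in> carrier T" "x2 \<in> carrier T" "\<phi> \<in> carrier H" for x1 x2 \<phi>
    using hom_space_ext[OF bilinear_mapD(1)[OF that(1)] forms_closed(2)[OF that(2-4)]] that
    by (auto simp: right_form_def)
  then show ?thesis
    unfolding is_hom_right_action_def Let_def by auto
qed

lemma ex1_left_action: "\<exists>!lact. is_hom_left_action K T br V \<theta> lact"
  using ex1_left_form by (simp add: is_hom_left_action_iff)

text \<open>Here the tensor is the second argument, so the extension of \<open>right_form\<close> is
  flipped and restricted again. Uniqueness is argued directly for the flipped order.\<close>

lemma ex1_right_action: "\<exists>!ract. is_hom_right_action K T br V \<theta> ract"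
proof (rule ex_ex1I)
  obtain \<beta> where \<beta>: "\<beta> \<in> carrier L \<rightarrow>\<^sub>E carrier H \<rightarrow>\<^sub>E carrier H" "bilinear_map K L H H \<beta>"
    "\<forall>x\<in>carrier T. \<forall>y\<in>carrier T. \<forall>\<phi>\<in>carrier H. \<beta> (tn x y) \<phi> = right_form x y \<phi>"
    using ex1_implies_ex[OF ex1_right_form] by blast
  let ?r = "\<lambda>\<phi>\<in>carrier H. \<lambda>z\<in>carrier L. \<beta> z \<phi>"
  have "bilinear_map K H L H ?r"
    by (rule bilinear_mapI) (simp_all add: bilinear_mapD[OF \<beta>(2)])
  moreover have "?r \<in> carrier H \<rightarrow>\<^sub>E carrier L \<rightarrow>\<^sub>E carrier H"
    using bilinear_mapD(1)[OF \<beta>(2)] by auto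
  ultimately show "\<exists>ract. is_hom_right_action K T br V \<theta> ract"
    unfolding is_hom_right_action_iff using \<beta>(3) by (intro exI[of _ ?r]) simp
next
  fix r s
  assume r: "is_hom_right_action K T br V \<theta> r" and s: "is_hom_right_action K T br V \<theta> s"
  note rs = r[unfolded is_hom_right_action_iff] s[unfolded is_hom_right_action_iff]
  have "r \<phi> z = s \<phi> z" if "z \<in> carrier L" "\<phi> \<in> carrier H" for z \<phi>
    by (rule tensor_linear_ext[OF module_axioms module_axioms _ _ _ that(1), of H "r \<phi>" "s \<phi>"])
      (use rs that(2) in \<open>auto simp: bilinear_map_def\<close>)
  then show "r = s"
    using rs by (intro PiE_ext[of _ "carrier H" "\<lambda>_. carrier L \<rightarrow>\<^sub>E carrier H"] PiE_ext[of _ "carrier L"]) auto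
qed

lemma hom_representation:
  assumes l: "is_hom_left_action K T br V \<theta> l" and r: "is_hom_right_action K T br V \<theta> r"
  shows "leibniz_representation K L mul H l r"
proof -
  interpret leibniz_algebra K L mul by (rule lts_leibniz_algebra)
  note tind = tensor_induct[OF module_axioms module_axioms, consumes 1, case_names pure add smult]
  have l_bil: "bilinear_map K L H H l" and r_bil: "bilinear_map K H L H r"
    using l r by (auto simp: is_hom_left_action_iff is_hom_right_action_iff)
  note bil [simp] = bilinear_mapD[OF l_bil] bilinear_mapD[OF r_bil] bilinear_mapD[OF mul_bilinear]
  have l_pure [simp]: "l (tn x1 x2) \<phi> x3 = D x1 x2 (\<phi> x3) \<ominus>\<^bsub>V\<^esub> \<phi> (br x1 x2 x3)"
    and r_pure [simp]: "r \<phi> (tn x1 x2) x3 = \<phi> (br x1 x2 x3) \<ominus>\<^bsub>V\<^esub> D x1 x2 (\<phi> x3)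
      \<oplus>\<^bsub>V\<^esub> th x1 x3 (\<phi> x2) \<ominus>\<^bsub>V\<^esub> th x2 x3 (\<phi> x1)"
    if "x1 \<in> carrier T" "x2 \<in> carrier T" "\<phi> \<in> carrier H" "x3 \<in> carrier T" for x1 x2 x3 \<phi>
    using l r that by (simp_all add: is_hom_left_action_def is_hom_right_action_def Let_def)
  note V_simps = rep.M.diff_simps rep.M.a_ac hom_space_apply
    hom_space_minus_apply[OF module_axioms rep.module_axioms]
  \<comment> \<open>On pure tensors, terms with \<open>D\<close> of one tensor outside
    \<open>m\<close> and \<open>br\<close> of the other inside cancel in the commutator. The rest is
    \<open>D_D\<close> outside \<open>m\<close> and \<open>br_derivation\<close> inside.\<close>
  have LLM: "l (mul x y) m = l x (l y m) \<ominus>\<^bsub>H\<^esub> l y (l x m)"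
    if x: "x \<in> carrier L" and y: "y \<in> carrier L" and m: "m \<in> carrier H" for x y m
    using x
  proof (induction rule: tind)
    case x: (pure x1 x2)
    show ?case
      using y
    proof (induction rule: tind)
      case y: (pure y1 y2)
      show ?case
      proof (rule hom_space_ext[of _ K T V])
        fix z assume z: "z \<in> carrier T"
        show "l (mul (tn x1 x2) (tn y1 y2)) m z =
            (l (tn x1 x2) (l (tn y1 y2) m) \<ominus>\<^bsub>H\<^esub> l (tn y1 y2) (l (tn x1 x2) m)) z"
          using x y z m br_derivation[of x1 x2 y1 y2 z] D_D[of x1 x2 y1 y2 "m z"]
          by (simp add: V_simps)
      qed (use x y m in simp_all)
    qed (use x m in \<open>simp_all add: H.diff_add_diff H.smult_diff\<close>)
  qed (use y m in \<open>simp_all add: H.diff_add_diff H.smult_diff\<close>)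
  \<comment> \<open>The terms without \<theta> cancel as for the left action. For the others,
    \<open>D_th\<close> gives three terms: the one acting on \<open>z\<close> is removed by the left
    action, the one acting on \<open>y1\<close> or \<open>y2\<close> belongs to
    \<open>r m (mul x y)\<close>, and the one acting on the vector to \<open>r (l x m) y\<close>.
    The terms with \<open>m (br x1 x2 y1)\<close> and \<open>m (br x1 x2 y2)\<close> cancel on the
    right-hand side.\<close>
  have LML: "l x (r m y) = r (l x m) y \<oplus>\<^bsub>H\<^esub> r m (mul x y)"
    if x: "x \<in> carrier L" and y: "y \<in> carrier L" and m: "m \<in> carrier H" for x y m
    using x
  proof (induction rule: tind)
    case x: (pure x1 x2)
    show ?case
      using y
    proof (induction rule: tind)
      case y: (pure y1 y2)
      show ?case
      proof (rule hom_space_ext[of _ K T V])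
        fix z assume z: "z \<in> carrier T"
        show "l (tn x1 x2) (r m (tn y1 y2)) z =
            (r (l (tn x1 x2) m) (tn y1 y2) \<oplus>\<^bsub>H\<^esub> r m (mul (tn x1 x2) (tn y1 y2))) z"
          using x y z m br_derivation[of x1 x2 y1 y2 z] D_D[of x1 x2 y1 y2 "m z"]
            D_th[of x1 x2 y1 z "m y2"] D_th[of x1 x2 y2 z "m y1"]
          by (simp add: V_simps)
      qed (use x y m in simp_all)
    qed (use x m in \<open>simp_all add: H.a_ac H.smult_r_distr\<close>)
  qed (use y m in \<open>simp_all add: H.a_ac H.smult_r_distr\<close>)
  \<comment> \<open>For fixed \<open>x\<close> and \<open>v\<close>, (R2) says exactly that the
    right action of every pure tensor kills the map sending \<open>z\<close> to
    \<open>th x z v\<close>. On a pure tensor, \<open>r m x\<close> plus \<open>l x m\<close> is a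
    difference of two such maps.\<close>
  have r_sum: "r (r m x \<oplus>\<^bsub>H\<^esub> l x m) y = \<zero>\<^bsub>H\<^esub>"
    if x: "x \<in> carrier L" and y: "y \<in> carrier L" and m: "m \<in> carrier H" for x y m
    using x
  proof (induction rule: tind)
    case x: (pure x1 x2)
    let ?\<psi> = "r m (tn x1 x2) \<oplus>\<^bsub>H\<^esub> l (tn x1 x2) m"
    have \<psi>: "?\<psi> \<in> carrier H" using x m by simp
    have \<psi>_apply: "?\<psi> z = th x1 z (m x2) \<ominus>\<^bsub>V\<^esub> th x2 z (m x1)" if "z \<in> carrier T" for z
      using x m that by (simp add: V_simps)
    show ?case
      using y
    proof (induction rule: tind)
      case y: (pure y1 y2)
      show ?case
      proof (rule hom_space_ext[of _ K T V])
        fix z assume z: "z \<in> carrier T"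
        \<comment> \<open>\<open>r_pure\<close> is applied to the sum \<open>?\<psi>\<close> as a
          whole; simplification would split it by additivity and lose the short formula
          \<open>\<psi>_apply\<close>.\<close>
        have "r ?\<psi> (tn y1 y2) z = ?\<psi> (br y1 y2 z) \<ominus>\<^bsub>V\<^esub> D y1 y2 (?\<psi> z)
            \<oplus>\<^bsub>V\<^esub> th y1 z (?\<psi> y2) \<ominus>\<^bsub>V\<^esub> th y2 z (?\<psi> y1)"
          using y z by (intro r_pure \<psi>) auto
        also have "\<dots> = \<zero>\<^bsub>V\<^esub>"
          using x y z m by (simp add: \<psi>_apply th_br rep.M.diff_simps rep.M.a_ac)
        finally show "r ?\<psi> (tn y1 y2) z = \<zero>\<^bsub>H\<^esub> z" using z by (simp add: hom_space_apply)
      qed (use \<psi> y in simp_all)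
    qed (use \<psi> in simp_all)
  next
    case (add x x')
    \<comment> \<open>The induction hypotheses concern \<open>r m x\<close> and \<open>l x m\<close>
      only in their sum, so the terms are regrouped before \<open>r\<close> is applied.
      \<open>bil(7)\<close> and \<open>bil(9)\<close> are additivity and homogeneity of
      \<open>r\<close> in its first argument.\<close>
    have "r m (x \<oplus>\<^bsub>L\<^esub> x') \<oplus>\<^bsub>H\<^esub> l (x \<oplus>\<^bsub>L\<^esub> x') m
        = (r m x \<oplus>\<^bsub>H\<^esub> l x m) \<oplus>\<^bsub>H\<^esub> (r m x' \<oplus>\<^bsub>H\<^esub> l x' m)"
      using add m by (simp add: H.a_ac)
    then show ?case
      using add y m bil(7)[of "r m x \<oplus>\<^bsub>H\<^esub> l x m" "r m x' \<oplus>\<^bsub>H\<^esub> l x' m" y] by simp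
  next
    case (smult a x)
    have "r m (a \<odot>\<^bsub>L\<^esub> x) \<oplus>\<^bsub>H\<^esub> l (a \<odot>\<^bsub>L\<^esub> x) m = a \<odot>\<^bsub>H\<^esub> (r m x \<oplus>\<^bsub>H\<^esub> l x m)"
      using smult m by (simp add: H.smult_r_distr)
    then show ?case
      using smult y m bil(9)[of a "r m x \<oplus>\<^bsub>H\<^esub> l x m" y] by simp
  qed
  show ?thesis
  proof (intro leibniz_representation.intro leibniz_representation_axioms.intro
      lts_leibniz_algebra H.module_axioms l_bil r_bil LLM LML)
    fix x y m assume xym: "x \<in> carrier L" "y \<in> carrier L" "m \<in> carrier H"
    have "r (r m x) y \<oplus>\<^bsub>H\<^esub> l x (r m y) = r (r m x \<oplus>\<^bsub>H\<^esub> l x m) y \<oplus>\<^bsub>H\<^esub> r m (mul x y)"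
      using xym by (simp add: LML H.a_ac)
    also have "\<dots> = r m (mul x y)"
      using xym by (simp only: r_sum[OF xym] H.l_zero bil)
    finally show "r m (mul x y) = r (r m x) y \<oplus>\<^bsub>H\<^esub> l x (r m y)" by (rule sym)
  qed
qed

end

text \<open>The maps "determined by" the formulas are captured by unique existence; the last
  conjunct speaks of all maps satisfying the predicates, and unique existence keeps it from being
  vacuous.\<close>

theorem corollary2p3:
  fixes K :: "('k, 'a) ring_scheme"
    and T :: "('k, 't, 'b) module_scheme"
    and br :: "'t \<Rightarrow> 't \<Rightarrow> 't \<Rightarrow> 't"
    and V :: "('k, 'v, 'c) module_scheme"
    and \<theta> :: "('t \<times> 't \<Rightarrow> 'k) set \<Rightarrow> 'v \<Rightarrow> 'v"
  assumes "algebraically_closed K"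
    and "characteristic K \<noteq> 2" and "characteristic K \<noteq> 3"
    and "lie_triple_system K T br"
    and "lts_representation K T br V \<theta>"
  shows "is_lts_product K T br (lts_product K T br)
    \<and> leibniz_algebra K (tensor_square K T) (lts_product K T br)
    \<and> (\<exists>!lact. is_hom_left_action K T br V \<theta> lact)
    \<and> (\<exists>!ract. is_hom_right_action K T br V \<theta> ract)
    \<and> (\<forall>lact ract. is_hom_left_action K T br V \<theta> lact \<longrightarrow> is_hom_right_action K T br V \<theta> ract \<longrightarrow>
         leibniz_representation K (tensor_square K T) (lts_product K T br) (hom_space K T V) lact ract)"
proof -
  interpret lts_representation K T br V \<theta> by fact
  show ?thesis
    using lts_product lts_leibniz_algebra ex1_left_action ex1_right_action hom_representation by blast
qed

end
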